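(* Let $p$ be a prime and let $G$ be a finite group which has only two conjugacy class sizes, $1$ and $p$ (that is, the set of conjugacy class sizes of $G$ is $\{1,p\}$). Then $G$ is isoclinic to a finite extraspecial $p$-group.
   Context: Two groups $G$ and $H$ are isoclinic if there are isomorphisms $\alpha: G/Z(G)\to H/Z(H)$ and $\beta:\gamma_2(G)\to\gamma_2(H)$ (with $\gamma_2$ the commutator subgroup and $Z$ the center) such that $\beta([g_1,g_2]) = [h_1,h_2]$ whenever $g_1,g_2\in G$, $h_1,h_2\in H$ satisfy $\alpha(g_iZ(G)) = h_iZ(H)$ for $i=1,2$. A $p$-group $G$ is special if $Z(G)=\gamma_2(G)=\Phi(G)$ (Frattini subgroup), and extraspecial if in addition $|Z(G)|=p$. *)

theory Defs
  imports "HOL-Algebra.Algebra"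
begin

definition conjugacy_class :: "('a, 'b) monoid_scheme \<Rightarrow> 'a \<Rightarrow> 'a set" where
  "conjugacy_class G x =
     orbit G (\<lambda>g. \<lambda>h \<in> carrier G. g \<otimes>\<^bsub>G\<^esub> h \<otimes>\<^bsub>G\<^esub> inv\<^bsub>G\<^esub> g) x"

definition conjugacy_class_sizes :: "('a, 'b) monoid_scheme \<Rightarrow> nat set" where
  "conjugacy_class_sizes G = {card (conjugacy_class G x) | x. x \<in> carrier G}"

definition center :: "('a, 'b) monoid_scheme \<Rightarrow> 'a set" where
  "center G = {z \<in> carrier G. \<forall>g \<in> carrier G. z \<otimes>\<^bsub>G\<^esub> g = g \<otimes>\<^bsub>G\<^esub> z}"

text \<open>The convention $[x,y] = x y x^{-1} y^{-1}$ is the one used by the library in \<^const>\<open>derived\<close>.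
  Isoclinism does not depend on it, since $x^{-1} y^{-1} x y = [x^{-1},y^{-1}]$.\<close>

definition commutator :: "('a, 'b) monoid_scheme \<Rightarrow> 'a \<Rightarrow> 'a \<Rightarrow> 'a" where
  "commutator G x y = x \<otimes>\<^bsub>G\<^esub> y \<otimes>\<^bsub>G\<^esub> inv\<^bsub>G\<^esub> x \<otimes>\<^bsub>G\<^esub> inv\<^bsub>G\<^esub> y"

abbreviation commutator_subgroup :: "('a, 'b) monoid_scheme \<Rightarrow> 'a set" where
  "commutator_subgroup G \<equiv> derived G (carrier G)"

definition maximal_subgroup :: "'a set \<Rightarrow> ('a, 'b) monoid_scheme \<Rightarrow> bool" where
  "maximal_subgroup M G \<longleftrightarrow>
     subgroup M G \<and> M \<noteq> carrier G \<and>
     (\<forall>K. subgroup K G \<and> M \<subseteq> K \<longrightarrow> K = M \<or> K = carrier G)"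

text \<open>Intersecting with the carrier makes the Frattini subgroup the whole group if there are no
  maximal subgroups.\<close>

definition frattini :: "('a, 'b) monoid_scheme \<Rightarrow> 'a set" where
  "frattini G = carrier G \<inter> \<Inter>{M. maximal_subgroup M G}"

text \<open>The order \<^term>\<open>group.ord G x\<close> is 0 for elements of infinite order, so these are excluded.\<close>

definition p_group :: "nat \<Rightarrow> ('a, 'b) monoid_scheme \<Rightarrow> bool" where
  "p_group p G \<longleftrightarrow>
     Factorial_Ring.prime p \<and> group G \<and> (\<forall>x \<in> carrier G. \<exists>n. group.ord G x = p ^ n)"

definition special_group :: "nat \<Rightarrow> ('a, 'b) monoid_scheme \<Rightarrow> bool" where
  "special_group p G \<longleftrightarrow>
     p_group p G \<and> center G = commutator_subgroup G \<and> commutator_subgroup G = frattini G"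

definition extraspecial_group :: "nat \<Rightarrow> ('a, 'b) monoid_scheme \<Rightarrow> bool" where
  "extraspecial_group p G \<longleftrightarrow> special_group p G \<and> card (center G) = p"

text \<open>The cosets forming \<^const>\<open>FactGroup\<close> are right cosets; modulo the center they are also the
  left cosets.\<close>

definition isoclinic :: "('a, 'c) monoid_scheme \<Rightarrow> ('b, 'd) monoid_scheme \<Rightarrow> bool" where
  "isoclinic G H \<longleftrightarrow>
     group G \<and> group H \<and>
     (\<exists>\<alpha> \<in> iso (G Mod center G) (H Mod center H).
      \<exists>\<beta> \<in> iso (G\<lparr>carrier := commutator_subgroup G\<rparr>) (H\<lparr>carrier := commutator_subgroup H\<rparr>).
        \<forall>g1 \<in> carrier G. \<forall>g2 \<in> carrier G. \<forall>h1 \<in> carrier H. \<forall>h2 \<in> carrier H.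
          \<alpha> (center G #>\<^bsub>G\<^esub> g1) = center H #>\<^bsub>H\<^esub> h1 \<and>
          \<alpha> (center G #>\<^bsub>G\<^esub> g2) = center H #>\<^bsub>H\<^esub> h2 \<longrightarrow>
          \<beta> (commutator G g1 g2) = commutator H h1 h2)"

end

theory Submission
  imports Defs "HOL-Number_Theory.Cong"
begin

text \<open>Let \<open>Z\<close> be the center. The conjugation action on \<open>G/Z\<close> has orbits of size \<open>1\<close> and \<open>p\<close>, and \<open>p\<close> divides
  \<open>|G : Z|\<close>, so some noncentral \<open>x\<close> is central modulo \<open>Z\<close>. Then \<open>N = [x, G]\<close> is a central subgroup of
  order \<open>p\<close>. If \<open>y\<close> does not commute with \<open>x\<close>, conjugating \<open>x y\<close> by powers of \<open>y\<close> yields all of \<open>N x y\<close>,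
  which is therefore the whole class of \<open>x y\<close>; hence \<open>[y, G] \<subseteq> N\<close>. The elements that do not commute
  with \<open>x\<close> generate \<open>G\<close>, so \<open>[G, G] = N\<close>.

  The commutator is thus an alternating form on \<open>G/Z\<close> with values in \<open>\<int>/p\<close>, and every such form is
  \<open>b(u, v) - b(v, u)\<close> for some biadditive \<open>b\<close>. Twisting \<open>\<int>/p \<times> G/Z\<close> by the cocycle \<open>b\<close> gives the
  extraspecial group.\<close>

section \<open>Commutators and the center\<close>

context group
begin

lemma inv_commutes:
  assumes "a \<in> carrier G" "x \<in> carrier G" "a \<otimes> x = x \<otimes> a"
  shows "inv a \<otimes> x = x \<otimes> inv a"
proof -
  have "inv a \<otimes> x = inv a \<otimes> (x \<otimes> a) \<otimes> inv a"
    using assms(1,2) by (simp add: m_assoc)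
  also have "\<dots> = x \<otimes> inv a"
    using assms(1,2) by (simp add: m_assoc[symmetric] flip: assms(3))
  finally show ?thesis .
qed

lemma center_memD: "z \<in> center G \<Longrightarrow> g \<in> carrier G \<Longrightarrow> z \<otimes> g = g \<otimes> z"
  by (simp add: center_def)

lemma center_closed: "z \<in> center G \<Longrightarrow> z \<in> carrier G"
  by (simp add: center_def)

lemma center_subgroup: "subgroup (center G) G"
proof
  fix x y assume x: "x \<in> center G" and y: "y \<in> center G"
  have "x \<otimes> y \<otimes> g = g \<otimes> (x \<otimes> y)" if "g \<in> carrier G" for g
    using that center_closed[OF x] center_closed[OF y] center_memD[OF x that] center_memD[OF y that]
    by (metis m_assoc)
  then show "x \<otimes> y \<in> center G"
    using center_closed[OF x] center_closed[OF y] by (simp add: center_def)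
next
  fix x assume x: "x \<in> center G"
  have "inv x \<otimes> g = g \<otimes> inv x" if "g \<in> carrier G" for g
    using inv_commutes[OF center_closed[OF x] that center_memD[OF x that]] .
  then show "inv x \<in> center G"
    using center_closed[OF x] by (simp add: center_def)
qed (auto simp: center_def)

lemma center_normal: "center G \<lhd> G"
proof (rule normal_invI[OF center_subgroup])
  fix x h assume x: "x \<in> carrier G" and h: "h \<in> center G"
  have "x \<otimes> h \<otimes> inv x = h"
    using x center_closed[OF h] center_memD[OF h x] by (metis inv_solve_right m_closed)
  then show "x \<otimes> h \<otimes> inv x \<in> center G"
    using h by simp
qed

lemma commutator_closed [simp]:
  "x \<in> carrier G \<Longrightarrow> y \<in> carrier G \<Longrightarrow> commutator G x y \<in> carrier G"
  by (simp add: commutator_def)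

lemma commutator_mult:
  assumes "x \<in> carrier G" "y \<in> carrier G"
  shows "commutator G x y \<otimes> (y \<otimes> x) = x \<otimes> y"
  using assms by (simp add: commutator_def m_assoc inv_solve_left flip: m_assoc[of "inv y"])

lemma commutator_eq_iff:
  assumes "x \<in> carrier G" "y \<in> carrier G" "n \<in> carrier G"
  shows "commutator G x y = n \<longleftrightarrow> x \<otimes> y = n \<otimes> (y \<otimes> x)"
  using assms right_cancel[of "y \<otimes> x" "commutator G x y" n]
  by (simp flip: commutator_mult[of x y])

lemma commutator_eq_one_iff:
  assumes "x \<in> carrier G" "y \<in> carrier G"
  shows "commutator G x y = \<one> \<longleftrightarrow> x \<otimes> y = y \<otimes> x"
  using assms by (simp add: commutator_eq_iff)

lemma conj_eq_commutator_mult: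
  assumes "g \<in> carrier G" "x \<in> carrier G"
  shows "g \<otimes> x \<otimes> inv g = commutator G g x \<otimes> x"
  using assms by (simp add: commutator_def m_assoc)

lemma center_iff_commutator:
  "z \<in> center G \<longleftrightarrow> z \<in> carrier G \<and> (\<forall>g \<in> carrier G. commutator G z g = \<one>)"
  by (auto simp: center_def commutator_eq_one_iff)

lemma commutator_self: "x \<in> carrier G \<Longrightarrow> commutator G x x = \<one>"
  by (simp add: commutator_eq_one_iff)

lemma commutator_swap:
  assumes "x \<in> carrier G" "y \<in> carrier G"
  shows "commutator G y x = inv (commutator G x y)"
  using assms by (simp add: commutator_def inv_mult_group m_assoc)

text \<open>Rewriting \<open>x (g h)\<close> as a multiple of \<open>(g h) x\<close> leaves
  \<open>commutator G x h\<close> behind \<open>g\<close>; its centrality brings it to the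
  front.\<close>

lemma commutator_mult_right_central:
  assumes "x \<in> carrier G" "g \<in> carrier G" "h \<in> carrier G" "commutator G x h \<in> center G"
  shows "commutator G x (g \<otimes> h) = commutator G x g \<otimes> commutator G x h"
proof -
  have "x \<otimes> (g \<otimes> h) = commutator G x g \<otimes> (g \<otimes> (x \<otimes> h))"
    using assms commutator_mult[of x g] by (metis m_assoc m_closed commutator_closed)
  also have "\<dots> = commutator G x g \<otimes> (g \<otimes> (commutator G x h \<otimes> (h \<otimes> x)))"
    using assms by (simp add: commutator_mult)
  also have "\<dots> = (commutator G x g \<otimes> commutator G x h) \<otimes> ((g \<otimes> h) \<otimes> x)"
    using assms center_memD[OF assms(4), of g] by (metis m_assoc m_closed commutator_closed)
  finally show ?thesis
    using assms by (simp add: commutator_eq_iff)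
qed

text \<open>Here \<open>commutator G h x\<close> has to travel, past \<open>g\<close> and past
  \<open>commutator G g x\<close>, so centrality is asked for the right factor
  \<open>h\<close>.\<close>

lemma commutator_mult_left_central:
  assumes "x \<in> carrier G" "g \<in> carrier G" "h \<in> carrier G" "commutator G h x \<in> center G"
  shows "commutator G (g \<otimes> h) x = commutator G g x \<otimes> commutator G h x"
proof -
  have "(g \<otimes> h) \<otimes> x = g \<otimes> (commutator G h x \<otimes> (x \<otimes> h))"
    using assms by (simp add: commutator_mult m_assoc)
  also have "\<dots> = commutator G h x \<otimes> ((g \<otimes> x) \<otimes> h)"
    using assms center_memD[OF assms(4), of g] by (metis m_assoc m_closed commutator_closed)
  also have "\<dots> = commutator G h x \<otimes> ((commutator G g x \<otimes> (x \<otimes> g)) \<otimes> h)"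
    using assms by (simp add: commutator_mult)
  also have "\<dots> = (commutator G g x \<otimes> commutator G h x) \<otimes> (x \<otimes> (g \<otimes> h))"
    using assms center_memD[OF assms(4), of "commutator G g x"]
    by (metis m_assoc m_closed commutator_closed)
  finally show ?thesis
    using assms by (simp add: commutator_eq_iff)
qed

lemma commutator_pow_right_central:
  assumes "x \<in> carrier G" "g \<in> carrier G" "commutator G x g \<in> center G"
  shows "commutator G x (g [^] (k::nat)) = commutator G x g [^] k"
proof (induction k)
  case 0
  show ?case using assms by (simp add: commutator_eq_one_iff)
next
  case (Suc k)
  then show ?case using assms by (simp add: commutator_mult_right_central)
qed

lemma commutator_in_derived:
  assumes "x \<in> carrier G" "y \<in> carrier G"
  shows "commutator G x y \<in> commutator_subgroup G"
  unfolding derived_def commutator_def using assms by (auto intro: generate.incl)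

lemma commutator_subgroup_subset:
  assumes "subgroup N G" "\<And>x y. x \<in> carrier G \<Longrightarrow> y \<in> carrier G \<Longrightarrow> commutator G x y \<in> N"
  shows "commutator_subgroup G \<subseteq> N"
  unfolding derived_def
  by (rule generate_subgroup_incl[OF _ assms(1)]) (use assms(2) in \<open>auto simp: commutator_def\<close>)

section \<open>Conjugacy classes and centralizers\<close>

lemma conjugacy_class_eq:
  "x \<in> carrier G \<Longrightarrow> conjugacy_class G x = (\<lambda>g. g \<otimes> x \<otimes> inv g) ` carrier G"
  by (auto simp: conjugacy_class_def orbit_def)

definition centralizer :: "'a \<Rightarrow> 'a set"
  where "centralizer x = {g \<in> carrier G. g \<otimes> x = x \<otimes> g}"

lemma centralizer_subgroup:
  assumes "x \<in> carrier G"
  shows "subgroup (centralizer x) G"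
proof
  fix a b assume "a \<in> centralizer x" "b \<in> centralizer x"
  then show "a \<otimes> b \<in> centralizer x"
    using assms by (simp add: centralizer_def) (metis m_assoc)
next
  fix a assume "a \<in> centralizer x"
  then show "inv a \<in> centralizer x"
    using assms by (simp add: centralizer_def inv_commutes)
qed (use assms in \<open>auto simp: centralizer_def\<close>)

lemma conjugacy_class_card:
  assumes "x \<in> carrier G"
  shows "card (conjugacy_class G x) * card (centralizer x) = order G"
proof -
  let ?\<phi> = "\<lambda>g. \<lambda>h \<in> carrier G. g \<otimes> h \<otimes> inv g"
  have "stabilizer G ?\<phi> x = centralizer x"
    using assms by (auto simp: stabilizer_def centralizer_def inv_solve_right inv_solve_right')
  then show ?thesis
    using group_action.orbit_stabilizer_theorem[OF action_by_conjugation assms]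
    by (simp add: conjugacy_class_def)
qed

section \<open>Subgroups of prime order\<close>

lemma prime_order_subgroup_ord:
  assumes N: "subgroup N G" "card N = p" "Factorial_Ring.prime p" "c \<in> N" "c \<noteq> \<one>"
  shows "ord c = p"
proof -
  interpret S: group "G\<lparr>carrier := N\<rparr>"
    by (rule subgroup_imp_group[OF N(1)])
  have c: "c \<in> carrier G"
    using N subgroup.subset by blast
  have "c [^] p = \<one>"
    using S.pow_order_eq_1[of c] N by (simp add: order_def flip: nat_pow_consistent)
  then have "ord c dvd p"
    using c by (simp add: pow_eq_id)
  moreover have "ord c \<noteq> 1"
    using c N(5) by (simp add: ord_eq_1[simplified])
  ultimately show ?thesis
    using N(3) by (auto simp: prime_nat_iff)
qed

text \<open>As \<open>c\<close> has order \<open>p\<close>, its powers with exponents below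
  \<open>p\<close> are distinct, and by counting they exhaust \<open>N\<close>.\<close>

lemma prime_order_subgroup_power:
  assumes N: "subgroup N G" "card N = p" "Factorial_Ring.prime p" "c \<in> N" "c \<noteq> \<one>" "n \<in> N"
  shows "\<exists>k::nat. n = c [^] k"
proof -
  have c: "c \<in> carrier G"
    using N subgroup.subset by blast
  have p: "p > 0"
    using N(3) by (simp add: prime_gt_0_nat)
  have fin: "finite N"
    using N(2) p card_ge_0_finite by metis
  have "inj_on (\<lambda>k. c [^] k) {..<p}"
  proof (rule inj_onI)
    fix i j assume ij: "i \<in> {..<p}" "j \<in> {..<p}" "c [^] i = c [^] j"
    then have "c [^] int i = c [^] int j"
      by (simp add: int_pow_int)
    then have "int p dvd int j - int i"
      using int_pow_eq[OF c] prime_order_subgroup_ord[OF N(1-5)] by simp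
    then have "[int j = int i] (mod int p)"
      by (simp add: cong_iff_dvd_diff)
    then show "i = j"
      using ij(1,2) by (simp add: cong_def)
  qed
  then have "card ((\<lambda>k. c [^] k) ` {..<p}) = p"
    by (simp add: card_image)
  moreover have "(\<lambda>k. c [^] k) ` {..<p} \<subseteq> N"
    using subgroup.m_closed[OF N(1)] subgroup_int_pow_closed[OF N(1,4)] by (force simp flip: int_pow_int)
  ultimately have "(\<lambda>k. c [^] k) ` {..<p} = N"
    using N(2) fin by (simp add: card_subset_eq)
  then show ?thesis using N(6) by blast
qed

end

text \<open>Counting modulo \<open>p\<close>: if \<open>e\<close> were the only fixed point, all
  other orbits would have size divisible by \<open>p\<close>, and \<open>card E\<close> would be 1
  modulo \<open>p\<close>.\<close>

lemma (in group_action) exists_other_fixed_point: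
  assumes "finite E" "p dvd card E" "p \<noteq> 1"
    and orb: "\<And>x. x \<in> E \<Longrightarrow> card (orbit G \<phi> x) = 1 \<or> p dvd card (orbit G \<phi> x)"
    and e: "e \<in> E" "orbit G \<phi> e = {e}"
  shows "\<exists>x \<in> E. x \<noteq> e \<and> orbit G \<phi> x = {x}"
proof (rule ccontr)
  assume no: "\<not> ?thesis"
  let ?O = "orbits G E \<phi>"
  have fin: "finite ?O"
    using assms(1) by (simp add: orbits_def)
  have eO: "{e} \<in> ?O"
    using e by (force simp: orbits_def)
  have dvd: "p dvd card O'" if O': "O' \<in> ?O - {{e}}" for O'
  proof -
    obtain x where x: "x \<in> E" "O' = orbit G \<phi> x"
      using O' unfolding orbits_def by blast
    have "x \<in> O'" using x orbit_refl by simp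
    have "card O' \<noteq> 1"
    proof
      assume "card O' = 1"
      then have "O' = {x}" using \<open>x \<in> O'\<close> by (metis card_1_singletonE singletonD)
      moreover have "x \<noteq> e" using O' \<open>O' = {x}\<close> by auto
      ultimately show False using no x by auto
    qed
    with orb x show ?thesis by blast
  qed
  have "card E = (\<Sum>O' \<in> ?O. card O')"
    using disjoint_sum[OF assms(1), of "\<lambda>_. 1::nat"] by simp
  also have "\<dots> = 1 + (\<Sum>O' \<in> ?O - {{e}}. card O')"
    using sum.remove[OF fin eO, of card] by simp
  finally have "p dvd 1 + (\<Sum>O' \<in> ?O - {{e}}. card O')"
    using assms(2) by simp
  moreover have "p dvd (\<Sum>O' \<in> ?O - {{e}}. card O')"
    using dvd by (rule dvd_sum)
  ultimately show False
    using assms(3) by (metis dvd_add_left_iff nat_dvd_1_iff_1)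
qed

section \<open>Groups with class sizes 1 and p\<close>

lemma (in group) card_subgroup_dvd_subgroup:
  assumes "subgroup H G" "subgroup K G" "H \<subseteq> K"
  shows "card H dvd card K"
proof -
  have "subgroup H (G\<lparr>carrier := K\<rparr>)"
    using assms by (rule subgroup_incl)
  then show ?thesis
    using group.lagrange[OF subgroup_imp_group[OF assms(2)]] by (force simp: order_def dest: sym)
qed

section \<open>Cosets of the center and elements central modulo the center\<close>

context group
begin

abbreviation center_coset :: "'a \<Rightarrow> 'a set"
  where "center_coset g \<equiv> center G #> g"

lemma center_coset_eq_iff:
  assumes "a \<in> carrier G" "b \<in> carrier G"
  shows "center_coset a = center_coset b \<longleftrightarrow> a \<otimes> inv b \<in> center G"
proof
  assume "center_coset a = center_coset b"
  then have "a \<in> center_coset b"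
    using rcos_self[OF assms(1) center_subgroup] by simp
  then show "a \<otimes> inv b \<in> center G"
    using subgroup.rcos_module_imp[OF center_subgroup is_group assms(2)] by simp
next
  assume "a \<otimes> inv b \<in> center G"
  then have "a \<in> center_coset b"
    using subgroup.rcos_module_rev[OF center_subgroup is_group assms(2,1)] by simp
  then show "center_coset a = center_coset b"
    using repr_independence[OF _ assms(2) center_subgroup] by simp
qed

lemma center_coset_group_hom: "group_hom G (G Mod center G) center_coset"
  using normal.r_coset_hom_Mod[OF center_normal] normal.factorgroup_is_group[OF center_normal]
  by (simp add: group_hom_def group_hom_axioms_def)

lemma center_coset_commute_iff:
  assumes "a \<in> carrier G" "b \<in> carrier G"
  shows "center_coset (a \<otimes> b) = center_coset (b \<otimes> a) \<longleftrightarrow> commutator G a b \<in> center G"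
  using assms by (simp add: center_coset_eq_iff commutator_def inv_mult_group m_assoc)

text \<open>Such an \<open>x\<close> represents a nontrivial fixed point of conjugation on
  \<open>?Q\<close>. The acting group is \<open>G\<close> rather than \<open>?Q\<close>, so that
  stabilizers of cosets can be compared with centralizers in \<open>G\<close>.\<close>

lemma exists_second_center:
  assumes fin: "finite (carrier G)" and p: "Factorial_Ring.prime p"
    and sizes: "conjugacy_class_sizes G = {1, p}"
  shows "\<exists>x \<in> carrier G. x \<notin> center G \<and> (\<forall>g \<in> carrier G. commutator G x g \<in> center G)"
proof -
  let ?Q = "G Mod center G"
  interpret \<pi>: group_hom G ?Q center_coset
    by (rule center_coset_group_hom)
  define \<phi> where "\<phi> g = (\<lambda>U \<in> carrier ?Q. center_coset g \<otimes>\<^bsub>?Q\<^esub> U \<otimes>\<^bsub>?Q\<^esub> inv\<^bsub>?Q\<^esub> center_coset g)" for g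
  have "(\<lambda>g. \<lambda>U \<in> carrier ?Q. g \<otimes>\<^bsub>?Q\<^esub> U \<otimes>\<^bsub>?Q\<^esub> inv\<^bsub>?Q\<^esub> g) \<circ> center_coset \<in> hom G (BijGroup (carrier ?Q))"
    by (rule Group.hom_compose[OF \<pi>.homh \<pi>.H.conjugation_is_hom])
  then have "\<phi> \<in> hom G (BijGroup (carrier ?Q))"
    by (simp add: \<phi>_def[abs_def] comp_def)
  then interpret act: group_action G "carrier ?Q" \<phi>
    by (simp add: group_action_def group_hom_def group_hom_axioms_def group_BijGroup)
  have carrier_Q: "carrier ?Q = center_coset ` carrier G"
    by (rule carrier_FactGroup)
  have \<phi>: "\<phi> g (center_coset x) = center_coset (g \<otimes> x \<otimes> inv g)"
    if "g \<in> carrier G" "x \<in> carrier G" for g x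
    using that by (simp add: \<phi>_def carrier_Q)
  \<comment> \<open>The centralizer of \<open>x\<close> fixes the coset of \<open>x\<close>, so by
    orbit-stabilizer the orbit size divides the class size.\<close>
  have dvd: "card (orbit G \<phi> (center_coset x)) dvd card (conjugacy_class G x)"
    if x: "x \<in> carrier G" for x
  proof -
    have sub: "centralizer x \<subseteq> stabilizer G \<phi> (center_coset x)"
    proof
      fix h assume "h \<in> centralizer x"
      then have h: "h \<in> carrier G" "h \<otimes> x \<otimes> inv h = x"
        using x by (auto simp: centralizer_def inv_solve_right')
      then show "h \<in> stabilizer G \<phi> (center_coset x)"
        using \<phi>[OF h(1) x] by (simp only: stabilizer_def mem_Collect_eq)
    qed
    have Qx: "center_coset x \<in> carrier ?Q"
      using x by simp
    obtain m where m: "card (stabilizer G \<phi> (center_coset x)) = card (centralizer x) * m"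
      using card_subgroup_dvd_subgroup[OF centralizer_subgroup[OF x] act.stabilizer_subgroup[OF Qx] sub]
      by blast
    have "card (orbit G \<phi> (center_coset x)) * (card (centralizer x) * m)
        = card (conjugacy_class G x) * card (centralizer x)"
      using act.orbit_stabilizer_theorem[OF Qx] conjugacy_class_card[OF x] m by simp
    moreover have "card (centralizer x) > 0"
      using subgroup.finite_imp_card_positive[OF centralizer_subgroup[OF x] fin] .
    ultimately have "card (orbit G \<phi> (center_coset x)) * m = card (conjugacy_class G x)"
      by simp
    then show ?thesis by (metis dvd_triv_left)
  qed
  have orb: "card (orbit G \<phi> U) = 1 \<or> p dvd card (orbit G \<phi> U)" if U: "U \<in> carrier ?Q" for U
  proof -
    obtain x where x: "x \<in> carrier G" "U = center_coset x"
      using U unfolding carrier_Q by blast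
    have "card (conjugacy_class G x) \<in> {1, p}"
      using x(1) unfolding sizes[symmetric] conjugacy_class_sizes_def by blast
    then show ?thesis
      using dvd[OF x(1)] p x(2) by (auto simp: prime_nat_iff)
  qed
  \<comment> \<open>A class of size \<open>p\<close> shows that \<open>p\<close> divides the index
    of the center: the centralizer of \<open>y\<close> has index \<open>p\<close> and contains the
    center.\<close>
  obtain y where y: "y \<in> carrier G" "card (conjugacy_class G y) = p"
  proof -
    have "p \<in> conjugacy_class_sizes G"
      using sizes by simp
    then show ?thesis using that by (auto simp: conjugacy_class_sizes_def)
  qed
  have "center G \<subseteq> centralizer y"
    using y(1) by (auto simp: centralizer_def center_def)
  then obtain m where m: "card (centralizer y) = card (center G) * m"
    using card_subgroup_dvd_subgroup[OF center_subgroup centralizer_subgroup[OF y(1)]] by blast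
  have "card (carrier ?Q) * card (center G) = p * (card (center G) * m)"
    using lagrange[OF center_subgroup] conjugacy_class_card[OF y(1)] y(2) m by (simp add: FactGroup_def)
  moreover have "card (center G) > 0"
    using subgroup.finite_imp_card_positive[OF center_subgroup fin] .
  ultimately have "card (carrier ?Q) = p * m"
    by simp
  then have pdvd: "p dvd card (carrier ?Q)"
    by simp
  have one: "center_coset \<one> \<in> carrier ?Q"
    unfolding carrier_Q by (rule imageI[OF one_closed])
  have "\<phi> g (center_coset \<one>) = center_coset \<one>" if "g \<in> carrier G" for g
    using that \<phi>[OF that one_closed] by simp
  then have "orbit G \<phi> (center_coset \<one>) = {center_coset \<one>}"
    by (auto simp: orbit_def)
  \<comment> \<open>The center itself is one fixed point; counting supplies a second one, and any
    representative of it will do as \<open>x\<close>.\<close>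
  then obtain U where U: "U \<in> carrier ?Q" "U \<noteq> center_coset \<one>" "orbit G \<phi> U = {U}"
    using act.exists_other_fixed_point[OF _ pdvd _ orb one] fin not_prime_1 p carrier_Q
    by (metis finite_imageI)
  then obtain x where x: "x \<in> carrier G" "U = center_coset x"
    unfolding carrier_Q by blast
  have "x \<notin> center G"
    using U(2) x center_coset_eq_iff[of x \<one>] by simp
  moreover have "commutator G x g \<in> center G" if g: "g \<in> carrier G" for g
  proof -
    have "\<phi> g U \<in> orbit G \<phi> U"
      using g by (auto simp: orbit_def)
    then have "center_coset (g \<otimes> x \<otimes> inv g) = center_coset x"
      using U(3) x(2) \<phi>[OF g x(1)] by simp
    then have "g \<otimes> x \<otimes> inv g \<otimes> inv x \<in> center G"
      using x(1) g center_coset_eq_iff[of "g \<otimes> x \<otimes> inv g" x] by simp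
    then have "commutator G g x \<in> center G"
      by (simp add: commutator_def)
    then show ?thesis
      using subgroup.m_inv_closed[OF center_subgroup] commutator_swap[OF g x(1)] by simp
  qed
  ultimately show ?thesis using x(1) by blast
qed

text \<open>Centrality makes \<open>commutator G x\<close> a homomorphism, and the set is its
  image.\<close>

lemma commutators_with_second_center_subgroup:
  assumes x: "x \<in> carrier G" and cen: "\<And>g. g \<in> carrier G \<Longrightarrow> commutator G x g \<in> center G"
  shows "subgroup (commutator G x ` carrier G) G"
proof
  show "\<one> \<in> commutator G x ` carrier G"
    using commutator_self[OF x] x by (metis imageI)
next
  fix a b assume "a \<in> commutator G x ` carrier G" "b \<in> commutator G x ` carrier G"
  then show "a \<otimes> b \<in> commutator G x ` carrier G"
    using x cen by (auto simp flip: commutator_mult_right_central)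
next
  fix a assume "a \<in> commutator G x ` carrier G"
  then obtain g where g: "g \<in> carrier G" "a = commutator G x g" by blast
  have "commutator G x (inv g) \<otimes> commutator G x g = commutator G x (inv g \<otimes> g)"
    using x g cen commutator_mult_right_central[of x "inv g" g] by simp
  also have "\<dots> = \<one>"
    using x g by (simp add: commutator_eq_one_iff)
  finally have "inv a = commutator G x (inv g)"
    using x g by (simp add: inv_equality)
  then show "inv a \<in> commutator G x ` carrier G"
    using g by simp
qed (use x in auto)

text \<open>\<open>commutator G x g\<close> is \<open>x\<close> times the inverse of the conjugate
  of \<open>x\<close> by \<open>g\<close>, and inverting and translating are injective.\<close>

lemma card_commutators_with:
  assumes x: "x \<in> carrier G"
  shows "card (commutator G x ` carrier G) = card (conjugacy_class G x)"
proof -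
  have "commutator G x ` carrier G = (\<lambda>u. x \<otimes> inv u) ` conjugacy_class G x"
    using x by (auto simp: conjugacy_class_eq commutator_def inv_mult_group m_assoc image_image)
  moreover have "inj_on (\<lambda>u. x \<otimes> inv u) (conjugacy_class G x)"
    using x by (intro inj_onI) (auto simp: conjugacy_class_eq)
  ultimately show ?thesis
    by (simp add: card_image)
qed

text \<open>The class of \<open>x \<otimes> y\<close> contains all \<open>p\<close> elements
  \<open>n \<otimes> (x \<otimes> y)\<close> with \<open>n \<in> N\<close> and therefore consists of
  them, so conjugation changes \<open>x \<otimes> y\<close> only by a factor in \<open>N\<close>.
  The factor \<open>x\<close> is cancelled later, once closure under products is available.\<close>

lemma commutator_in_of_noncommuting:
  assumes fin: "finite (carrier G)" and p: "Factorial_Ring.prime p"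
    and sizes: "\<And>x. x \<in> carrier G \<Longrightarrow> card (conjugacy_class G x) \<in> {1, p}"
    and x: "x \<in> carrier G" and y: "y \<in> carrier G"
    and cen: "\<And>g. g \<in> carrier G \<Longrightarrow> commutator G x g \<in> center G"
    and N: "N = commutator G x ` carrier G" and ne: "commutator G x y \<noteq> \<one>"
    and g: "g \<in> carrier G"
  shows "commutator G (x \<otimes> y) g \<in> N"
proof -
  have subN: "subgroup N G"
    unfolding N by (rule commutators_with_second_center_subgroup[OF x cen])
  have "N = {\<one>}" if "card N = 1"
    using that subgroup.one_closed[OF subN] by (metis card_1_singletonE singletonD)
  moreover have "commutator G x y \<in> N"
    using N y by blast
  ultimately have cardN: "card N = p"
    using sizes[OF x] card_commutators_with[OF x] ne N by auto
  have "n \<otimes> (x \<otimes> y) \<in> conjugacy_class G (x \<otimes> y)" if n: "n \<in> N" for n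
  proof -
    have nc: "n \<in> carrier G"
      using n subN by (rule subgroup.mem_carrier[rotated])
    \<comment> \<open>Conjugating by \<open>y [^] j\<close> multiplies \<open>x \<otimes> y\<close>
      by \<open>commutator G (y [^] j) x\<close>, the inverse of
      \<open>commutator G x y [^] j\<close>; hence the exponent is chosen for
      \<open>inv n\<close>.\<close>
    have "inv n \<in> N"
      using n subgroup.m_inv_closed[OF subN] by simp
    then obtain j :: nat where j: "inv n = commutator G x y [^] j"
      using prime_order_subgroup_power[OF subN cardN p \<open>commutator G x y \<in> N\<close> ne] by blast
    let ?k = "y [^] j"
    have "inv n = commutator G x ?k"
      using j x y cen by (simp add: commutator_pow_right_central)
    then have kn: "commutator G ?k x = n"
      using commutator_swap[of x ?k] x y nc by (metis inv_inv nat_pow_closed)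
    have ky: "?k \<otimes> y = y \<otimes> ?k"
      using y by (simp add: nat_pow_comm[of y j 1, simplified])
    have "?k \<otimes> (x \<otimes> y) = (n \<otimes> (x \<otimes> ?k)) \<otimes> y"
      using kn commutator_mult[of ?k x] x y by (simp flip: m_assoc)
    also have "\<dots> = (n \<otimes> (x \<otimes> y)) \<otimes> ?k"
      using x y nc ky by (simp add: m_assoc)
    finally have "?k \<otimes> (x \<otimes> y) \<otimes> inv ?k = n \<otimes> (x \<otimes> y)"
      using x y nc by (simp add: inv_solve_right')
    then have "n \<otimes> (x \<otimes> y) = ?k \<otimes> (x \<otimes> y) \<otimes> inv ?k" by simp
    then show ?thesis
      using x y by (simp only: conjugacy_class_eq m_closed) (rule image_eqI[of _ _ ?k], simp_all)
  qed
  then have sub: "(\<lambda>n. n \<otimes> (x \<otimes> y)) ` N \<subseteq> conjugacy_class G (x \<otimes> y)"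
    by blast
  have "inj_on (\<lambda>n. n \<otimes> (x \<otimes> y)) N"
    using x y subgroup.mem_carrier[OF subN] by (intro inj_onI) auto
  then have card: "card ((\<lambda>n. n \<otimes> (x \<otimes> y)) ` N) = p"
    using cardN by (simp add: card_image)
  have fin_cl: "finite (conjugacy_class G (x \<otimes> y))"
    using fin x y by (simp add: conjugacy_class_eq)
  \<comment> \<open>The size is 1 or \<open>p\<close>, and the inclusion just shown forces at least
    \<open>p \<ge> 2\<close>.\<close>
  have "card (conjugacy_class G (x \<otimes> y)) = p"
    using card_mono[OF fin_cl sub] card sizes[of "x \<otimes> y"] x y prime_ge_2_nat[OF p] by auto
  then have "(\<lambda>n. n \<otimes> (x \<otimes> y)) ` N = conjugacy_class G (x \<otimes> y)"
    using card_subset_eq[OF fin_cl sub] card by simp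
  moreover have "g \<otimes> (x \<otimes> y) \<otimes> inv g \<in> conjugacy_class G (x \<otimes> y)"
    using g x y by (force simp: conjugacy_class_eq)
  ultimately obtain n where n: "n \<in> N" "g \<otimes> (x \<otimes> y) \<otimes> inv g = n \<otimes> (x \<otimes> y)"
    by auto
  then have "commutator G g (x \<otimes> y) = n"
    using g x y subgroup.mem_carrier[OF subN n(1)] conj_eq_commutator_mult[of g "x \<otimes> y"] by simp
  then show ?thesis
    using n(1) subgroup.m_inv_closed[OF subN] commutator_swap[of g "x \<otimes> y"] g x y by simp
qed

text \<open>The image form of the commutator subgroup is recorded because it exhibits each of its
  elements as a single commutator, which \<open>commutator_lift\<close> relies on.\<close>

lemma two_class_sizes_commutators:
  assumes fin: "finite (carrier G)" and p: "Factorial_Ring.prime p"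
    and sizes: "conjugacy_class_sizes G = {1, p}"
  obtains x where "x \<in> carrier G" "commutator_subgroup G = commutator G x ` carrier G"
    "commutator_subgroup G \<subseteq> center G" "card (commutator_subgroup G) = p"
proof -
  have sizes': "card (conjugacy_class G x) \<in> {1, p}" if "x \<in> carrier G" for x
    using that unfolding sizes[symmetric] conjugacy_class_sizes_def by blast
  obtain x where x: "x \<in> carrier G" "x \<notin> center G"
    and cen: "\<And>g. g \<in> carrier G \<Longrightarrow> commutator G x g \<in> center G"
    using exists_second_center[OF assms] by blast
  define N where "N = commutator G x ` carrier G"
  have subN: "subgroup N G"
    unfolding N_def by (rule commutators_with_second_center_subgroup[OF x(1) cen])
  have N_cen: "N \<subseteq> center G"
    using cen by (auto simp: N_def)
  \<comment> \<open>Since \<open>N\<close> is a central subgroup, \<open>P\<close> is closed under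
    products and inverses; the goal is that it holds on all of \<open>G\<close>.\<close>
  define P where "P y \<longleftrightarrow> y \<in> carrier G \<and> (\<forall>g \<in> carrier G. commutator G y g \<in> N)" for y
  have P_mult: "P (y \<otimes> z)" if "P y" "P z" for y z
    using that N_cen subgroup.m_closed[OF subN] unfolding P_def
    by (auto simp: commutator_mult_left_central subset_iff)
  have P_inv: "P (inv y)" if y: "P y" for y
  proof -
    have "commutator G (inv y) g = inv (commutator G y g)" if g: "g \<in> carrier G" for g
    proof -
      have "commutator G (inv y) g \<otimes> commutator G y g = commutator G (inv y \<otimes> y) g"
        using y g N_cen commutator_mult_left_central[of g "inv y" y] by (simp add: P_def subset_iff)
      also have "\<dots> = \<one>"
        using y g by (simp add: P_def commutator_eq_one_iff)
      finally show ?thesis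
        using y g by (simp add: P_def inv_equality)
    qed
    then show ?thesis
      using y subgroup.m_inv_closed[OF subN] by (simp add: P_def)
  qed
  have P_x: "P x"
    using x by (simp add: P_def N_def)
  have P_noncommuting: "P y" if y: "y \<in> carrier G" "commutator G x y \<noteq> \<one>" for y
  proof -
    have "P (x \<otimes> y)"
      using commutator_in_of_noncommuting[OF fin p sizes' x(1) y(1) cen N_def y(2)] x y
      by (simp add: P_def)
    then have "P (inv x \<otimes> (x \<otimes> y))"
      using P_mult P_inv P_x by blast
    then show ?thesis
      using x y by (simp flip: m_assoc)
  qed
  have P_all: "P y" if y: "y \<in> carrier G" for y
  proof (cases "commutator G x y = \<one>")
    case True
    \<comment> \<open>If \<open>z\<close> does not commute with \<open>x\<close>, neither does
      \<open>y \<otimes> z\<close>, so \<open>y\<close> is a quotient of two elements already known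
      to satisfy \<open>P\<close>.\<close>
    obtain z where z: "z \<in> carrier G" "commutator G x z \<noteq> \<one>"
      using x by (auto simp: center_iff_commutator)
    have "commutator G x (y \<otimes> z) \<noteq> \<one>"
      using True x y z cen by (simp add: commutator_mult_right_central)
    then have "P (y \<otimes> z \<otimes> inv z)"
      using P_noncommuting P_mult P_inv y z by simp
    then show ?thesis
      using y z by (simp add: m_assoc)
  qed (use P_noncommuting y in blast)
  have "commutator_subgroup G \<subseteq> N"
    using commutator_subgroup_subset[OF subN] P_all by (simp add: P_def)
  moreover have "N \<subseteq> commutator_subgroup G"
    using commutator_in_derived x(1) by (auto simp: N_def)
  ultimately have eq: "commutator_subgroup G = N" by blast
  have "N \<noteq> {\<one>}"
    using x by (auto simp: N_def center_iff_commutator)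
  then have "card N \<noteq> 1"
    using subgroup.one_closed[OF subN] by (metis card_1_singletonE singletonD)
  then have "card N = p"
    using sizes'[OF x(1)] card_commutators_with[OF x(1)] by (auto simp: N_def)
  then show thesis
    using that[OF x(1)] eq N_cen by (simp add: N_def)
qed

end

section \<open>Alternating forms modulo a prime\<close>

text \<open>A biadditive map into Z/p, given by integer representatives that matter only modulo
  \<open>p\<close>.\<close>

definition biadditive_mod :: "int \<Rightarrow> ('a, 'b) monoid_scheme \<Rightarrow> ('a \<Rightarrow> 'a \<Rightarrow> int) \<Rightarrow> bool" where
  "biadditive_mod p Q f \<longleftrightarrow>
     (\<forall>g \<in> carrier Q. \<forall>h \<in> carrier Q. \<forall>k \<in> carrier Q.
        [f (g \<otimes>\<^bsub>Q\<^esub> h) k = f g k + f h k] (mod p) \<and>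
        [f k (g \<otimes>\<^bsub>Q\<^esub> h) = f k g + f k h] (mod p))"

lemma biadditive_mod_left:
  assumes "biadditive_mod p Q f" "g \<in> carrier Q" "h \<in> carrier Q" "k \<in> carrier Q"
  shows "[f (g \<otimes>\<^bsub>Q\<^esub> h) k = f g k + f h k] (mod p)"
  using assms by (simp add: biadditive_mod_def)

lemma biadditive_mod_right:
  assumes "biadditive_mod p Q f" "g \<in> carrier Q" "h \<in> carrier Q" "k \<in> carrier Q"
  shows "[f k (g \<otimes>\<^bsub>Q\<^esub> h) = f k g + f k h] (mod p)"
  using assms by (simp add: biadditive_mod_def)

text \<open>The correction by a product of two additive functions, used both to reduce
  \<open>w\<close> in the induction below and to rebuild \<open>b\<close> afterwards.\<close>

lemma biadditive_mod_add_product: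
  assumes f: "biadditive_mod p Q f" and u: "biadditive_mod p Q u"
    and x: "x \<in> carrier Q" and y: "y \<in> carrier Q"
  shows "biadditive_mod p Q (\<lambda>g h. f g h + r * (u g y * u x h))"
  unfolding biadditive_mod_def
proof (intro ballI conjI)
  fix g h k assume g: "g \<in> carrier Q" and h: "h \<in> carrier Q" and k: "k \<in> carrier Q"
  have "[f (g \<otimes>\<^bsub>Q\<^esub> h) k + r * (u (g \<otimes>\<^bsub>Q\<^esub> h) y * u x k)
      = (f g k + f h k) + r * ((u g y + u h y) * u x k)] (mod p)"
    by (intro cong_add cong_mult cong_refl biadditive_mod_left[OF f] biadditive_mod_left[OF u] g h k y)
  then show "[f (g \<otimes>\<^bsub>Q\<^esub> h) k + r * (u (g \<otimes>\<^bsub>Q\<^esub> h) y * u x k)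
      = f g k + r * (u g y * u x k) + (f h k + r * (u h y * u x k))] (mod p)"
    by (simp add: algebra_simps)
  have "[f k (g \<otimes>\<^bsub>Q\<^esub> h) + r * (u k y * u x (g \<otimes>\<^bsub>Q\<^esub> h))
      = (f k g + f k h) + r * (u k y * (u x g + u x h))] (mod p)"
    by (intro cong_add cong_mult cong_refl biadditive_mod_right[OF f] biadditive_mod_right[OF u] g h k x)
  then show "[f k (g \<otimes>\<^bsub>Q\<^esub> h) + r * (u k y * u x (g \<otimes>\<^bsub>Q\<^esub> h))
      = f k g + r * (u k y * u x g) + (f k h + r * (u k y * u x h))] (mod p)"
    by (simp add: algebra_simps)
qed

lemma biadditive_mod_swap:
  "biadditive_mod p Q f \<Longrightarrow> biadditive_mod p Q (\<lambda>g h. f h g)"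
  by (auto simp: biadditive_mod_def)

text \<open>Polarization: expand \<open>f (g \<otimes> h) (g \<otimes> h)\<close> and drop the
  diagonal terms.\<close>

lemma (in group) alternating_mod_antisym:
  assumes f: "biadditive_mod p G f" and alt: "\<And>g. g \<in> carrier G \<Longrightarrow> [f g g = 0] (mod p)"
    and g: "g \<in> carrier G" and h: "h \<in> carrier G"
  shows "[f g h = - f h g] (mod p)"
proof -
  have "[f (g \<otimes> h) (g \<otimes> h) = f g (g \<otimes> h) + f h (g \<otimes> h)] (mod p)"
    by (intro biadditive_mod_left[OF f]) (use g h in auto)
  also have "[f g (g \<otimes> h) + f h (g \<otimes> h) = (f g g + f g h) + (f h g + f h h)] (mod p)"
    by (intro cong_add biadditive_mod_right[OF f] g h)
  also have "[(f g g + f g h) + (f h g + f h h) = (0 + f g h) + (f h g + 0)] (mod p)"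
    by (intro cong_add cong_refl alt g h)
  finally have "[f (g \<otimes> h) (g \<otimes> h) = f g h + f h g] (mod p)" by simp
  moreover have "[f (g \<otimes> h) (g \<otimes> h) = 0] (mod p)"
    by (intro alt m_closed g h)
  ultimately have "[f g h + f h g = 0] (mod p)"
    by (metis cong_sym cong_trans)
  then show ?thesis
    by (simp add: cong_iff_dvd_diff)
qed

text \<open>If \<open>w x y\<close> is nonzero, subtracting a suitable multiple of the antisymmetrization of
  \<open>(g, h) \<mapsto> w g y * w x h\<close> puts \<open>x\<close> into the radical and keeps what was there; so the
  induction is on the number of elements outside the radical.\<close>

lemma (in group) alternating_mod_eq_antisymmetrization:
  assumes fin: "finite (carrier G)" and p: "Factorial_Ring.prime (p::int)"
    and "biadditive_mod p G w" and "\<And>g. g \<in> carrier G \<Longrightarrow> [w g g = 0] (mod p)"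
  shows "\<exists>b. biadditive_mod p G b \<and>
    (\<forall>g \<in> carrier G. \<forall>h \<in> carrier G. [w g h = b g h - b h g] (mod p))"
  using assms(3,4)
proof (induction "card {g \<in> carrier G. \<exists>h \<in> carrier G. \<not> [w g h = 0] (mod p)}"
    arbitrary: w rule: less_induct)
  case less
  note w = \<open>biadditive_mod p G w\<close> and alt = \<open>\<And>g. g \<in> carrier G \<Longrightarrow> [w g g = 0] (mod p)\<close>
  show ?case
  proof (cases "\<exists>x \<in> carrier G. \<exists>y \<in> carrier G. \<not> [w x y = 0] (mod p)")
    case False
    then show ?thesis
      by (intro exI[of _ "\<lambda>_ _. 0"]) (auto simp: biadditive_mod_def)
  next
    case True
    then obtain x y where x: "x \<in> carrier G" and y: "y \<in> carrier G" and xy: "\<not> [w x y = 0] (mod p)"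
      by blast
    \<comment> \<open>Modulo the prime \<open>p\<close> the nonzero value \<open>w x y\<close> has
      an inverse \<open>r\<close>; with this scale the correction cancels \<open>w x h\<close>
      exactly.\<close>
    have "coprime (w x y) p"
      using xy p prime_imp_coprime[of p "w x y"] by (auto simp: cong_0_iff coprime_commute)
    then obtain r where r: "[w x y * r = 1] (mod p)"
      using cong_solve_coprime_int by blast
    define w' where "w' g h = (w g h + (- r) * (w g y * w x h)) + r * (w h y * w x g)" for g h
    \<comment> \<open>The two products differ by exchanging the arguments, so the second one is
      added between two swaps.\<close>
    have w': "biadditive_mod p G w'"
      using biadditive_mod_swap[OF biadditive_mod_add_product[OF
          biadditive_mod_swap[OF biadditive_mod_add_product[OF w w x y, of "- r"]] w x y, of r]]
      by (simp add: w'_def[abs_def])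
    have alt': "[w' g g = 0] (mod p)" if "g \<in> carrier G" for g
      using alt[OF that] by (simp add: w'_def)
    let ?S = "\<lambda>w. {g \<in> carrier G. \<exists>h \<in> carrier G. \<not> [w g h = 0] (mod p)}"
    have "[w' x h = 0] (mod p)" if h: "h \<in> carrier G" for h
    proof -
      have "[w' x h = w x h - (w x y * r) * w x h + r * (w h y * w x x)] (mod p)"
        by (simp add: w'_def algebra_simps)
      also have "[w x h - (w x y * r) * w x h + r * (w h y * w x x)
          = w x h - 1 * w x h + r * (w h y * 0)] (mod p)"
        by (intro cong_add cong_diff cong_mult cong_refl r alt x)
      finally show ?thesis by simp
    qed
    then have "x \<notin> ?S w'" by blast
    moreover have "x \<in> ?S w" using x y xy by blast
    moreover have "?S w' \<subseteq> ?S w"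
    proof
      fix g assume "g \<in> ?S w'"
      then obtain h where g: "g \<in> carrier G" and h: "h \<in> carrier G" "\<not> [w' g h = 0] (mod p)"
        by blast
      show "g \<in> ?S w"
      proof (rule ccontr)
        assume "g \<notin> ?S w"
        then have zero: "[w g k = 0] (mod p)" if "k \<in> carrier G" for k
          using that g by blast
        \<comment> \<open>Lying outside \<open>?S w\<close> concerns \<open>g\<close> as left
          argument only; antisymmetry transfers it to \<open>w x g\<close>.\<close>
        have "[w x g = - w g x] (mod p)"
          by (rule alternating_mod_antisym[OF w alt x g])
        also have "[- w g x = 0] (mod p)"
          using zero[OF x] by (simp add: cong_0_iff)
        finally have xg: "[w x g = 0] (mod p)" .
        have "[w' g h = (0 + (- r) * (0 * w x h)) + r * (w h y * 0)] (mod p)"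
          unfolding w'_def by (intro cong_add cong_mult cong_refl zero xg h y)
        then show False using h by simp
      qed
    qed
    ultimately have "?S w' \<subset> ?S w" by blast
    then have "card (?S w') < card (?S w)"
      using fin by (intro psubset_card_mono) auto
    then obtain b where b: "biadditive_mod p G b"
      and wb: "\<And>g h. g \<in> carrier G \<Longrightarrow> h \<in> carrier G \<Longrightarrow> [w' g h = b g h - b h g] (mod p)"
      using less(1)[OF _ w' alt'] by blast
    \<comment> \<open>\<open>w\<close> and \<open>w'\<close> differ by two terms; \<open>b\<close>
      receives only one of them, since antisymmetrizing produces the other. Nothing is halved, so
      \<open>p = 2\<close> is covered.\<close>
    let ?b = "\<lambda>g h. b g h + r * (w g y * w x h)"
    have "[w g h = ?b g h - ?b h g] (mod p)" if "g \<in> carrier G" "h \<in> carrier G" for g h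
    proof -
      have "w g h = w' g h + (r * (w g y * w x h) - r * (w h y * w x g))"
        by (simp add: w'_def)
      also have "[\<dots> = (b g h - b h g) + (r * (w g y * w x h) - r * (w h y * w x g))] (mod p)"
        by (intro cong_add cong_refl wb that)
      finally show ?thesis by (simp add: algebra_simps)
    qed
    moreover have "biadditive_mod p G ?b"
      by (rule biadditive_mod_add_product[OF b w x y])
    ultimately show ?thesis by blast
  qed
qed

section \<open>Extraspecial groups\<close>

context group
begin

lemma prime_order_subgroup_exponent:
  assumes "subgroup N G" "card N = p" "Factorial_Ring.prime p" "n \<in> N"
  shows "n [^] p = \<one>"
proof (cases "n = \<one>")
  case False
  then show ?thesis
    using prime_order_subgroup_ord[OF assms] subgroup.mem_carrier[OF assms(1,4)] pow_ord_eq_1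
    by metis
qed simp

text \<open>\<open>commutator G v\<close> is a homomorphism into the center, which has prime order,
  and its kernel is \<open>centralizer v\<close>. An element \<open>k\<close> of \<open>K\<close>
  outside the kernel has an image generating the center, so every \<open>h\<close> is a kernel
  element times a power of \<open>k\<close>.\<close>

lemma centralizer_maximal:
  assumes p: "Factorial_Ring.prime p" and card: "card (center G) = p"
    and cen: "\<And>g h. g \<in> carrier G \<Longrightarrow> h \<in> carrier G \<Longrightarrow> commutator G g h \<in> center G"
    and v: "v \<in> carrier G" "v \<notin> center G"
  shows "maximal_subgroup (centralizer v) G"
  unfolding maximal_subgroup_def
proof (intro conjI allI impI)
  show "subgroup (centralizer v) G"
    by (rule centralizer_subgroup[OF v(1)])
  show "centralizer v \<noteq> carrier G"
  proof
    assume "centralizer v = carrier G"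
    then have "v \<otimes> g = g \<otimes> v" if "g \<in> carrier G" for g
      using that by (metis (mono_tags, lifting) centralizer_def mem_Collect_eq)
    then show False
      using v by (simp add: center_def)
  qed
next
  fix K assume K: "subgroup K G \<and> centralizer v \<subseteq> K"
  have centralizer_iff: "h \<in> centralizer v \<longleftrightarrow> commutator G v h = \<one>" if "h \<in> carrier G" for h
    using that v by (auto simp: centralizer_def commutator_eq_one_iff)
  show "K = centralizer v \<or> K = carrier G"
  proof (rule disjCI)
    assume "K \<noteq> carrier G"
    show "K = centralizer v"
    proof (rule ccontr)
      assume "K \<noteq> centralizer v"
      then obtain k where k: "k \<in> K" "k \<notin> centralizer v"
        using K by blast
      have kG: "k \<in> carrier G"
        using k K subgroup.mem_carrier by metis
      have "h \<in> K" if h: "h \<in> carrier G" for h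
      proof -
        obtain j :: nat where j: "commutator G v h = commutator G v k [^] j"
          using prime_order_subgroup_power[OF center_subgroup card p cen[OF v(1) kG] _ cen[OF v(1) h]]
            k(2) centralizer_iff[OF kG] by blast
        let ?k = "k [^] j"
        have kj: "?k \<in> K"
          using k(1) K subgroup_int_pow_closed[of K k "int j"] by (simp add: int_pow_int)
        have "commutator G v (h \<otimes> inv ?k \<otimes> ?k) = commutator G v (h \<otimes> inv ?k) \<otimes> commutator G v ?k"
          using v h kG cen by (intro commutator_mult_right_central) auto
        then have "commutator G v ?k = commutator G v (h \<otimes> inv ?k) \<otimes> commutator G v ?k"
          using j v h kG cen by (simp add: m_assoc commutator_pow_right_central)
        then have "commutator G v (h \<otimes> inv ?k) = \<one>"
          using v h kG by (metis commutator_closed inv_closed m_closed nat_pow_closed r_cancel_one')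
        then have "h \<otimes> inv ?k \<in> K"
          using K h kG centralizer_iff by auto
        then have "h \<otimes> inv ?k \<otimes> ?k \<in> K"
          using kj K subgroup.m_closed by metis
        then show ?thesis
          using h kG by (simp add: m_assoc)
      qed
      then show False
        using K \<open>K \<noteq> carrier G\<close> subgroup.subset by blast
    qed
  qed
qed

text \<open>If the center is not inside the maximal subgroup \<open>M\<close>, then \<open>G = Z(G) M\<close>, so every commutator
  of \<open>G\<close> is a commutator of \<open>M\<close>.\<close>

lemma central_commutator_subgroup_subset_maximal:
  assumes eq: "center G = commutator_subgroup G" and M: "maximal_subgroup M G"
  shows "center G \<subseteq> M"
proof -
  have sub: "subgroup M G"
    using M by (simp add: maximal_subgroup_def)
  note Z = center_subgroup
  note MG = subgroup.mem_carrier[OF sub] and ZG = center_closed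
  \<comment> \<open>The product of the center and \<open>M\<close> is a subgroup containing
    \<open>M\<close>, so maximality leaves only \<open>M\<close> and the whole group.\<close>
  define K where "K = {z \<otimes> m | z m. z \<in> center G \<and> m \<in> M}"
  have KI: "z \<otimes> m \<in> K" if "z \<in> center G" "m \<in> M" for z m
    using that by (auto simp: K_def)
  have "subgroup K G"
  proof
    show "K \<subseteq> carrier G"
      using MG ZG by (auto simp: K_def)
    show "\<one> \<in> K"
      using KI[OF subgroup.one_closed[OF Z] subgroup.one_closed[OF sub]] by simp
  next
    fix a b assume "a \<in> K" "b \<in> K"
    then obtain z m z' m' where *: "z \<in> center G" "m \<in> M" "z' \<in> center G" "m' \<in> M"
      "a = z \<otimes> m" "b = z' \<otimes> m'"
      by (auto simp: K_def)
    have "a \<otimes> b = (z \<otimes> z') \<otimes> (m \<otimes> m')"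
      using * MG ZG center_memD[of z' m] by (simp add: m_assoc) (simp flip: m_assoc)
    then show "a \<otimes> b \<in> K"
      using KI subgroup.m_closed[OF Z] subgroup.m_closed[OF sub] * by simp
  next
    fix a assume "a \<in> K"
    then obtain z m where *: "z \<in> center G" "m \<in> M" "a = z \<otimes> m"
      by (auto simp: K_def)
    have "inv a = inv z \<otimes> inv m"
      using * MG ZG center_memD[OF *(1) MG[OF *(2)]] by (simp add: inv_mult_group)
    then show "inv a \<in> K"
      using KI subgroup.m_inv_closed[OF Z] subgroup.m_inv_closed[OF sub] * by simp
  qed
  moreover have "M \<subseteq> K"
    using KI[OF subgroup.one_closed[OF Z]] MG by force
  ultimately consider "K = M" | "K = carrier G"
    using M by (auto simp: maximal_subgroup_def)
  then show ?thesis
  proof cases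
    case 1
    then show ?thesis
      using KI[OF _ subgroup.one_closed[OF sub]] ZG by force
  next
    case 2
    have cen: "commutator G a b \<in> center G" if "a \<in> carrier G" "b \<in> carrier G" for a b
      using that commutator_in_derived eq by simp
    have "commutator G a b \<in> M" if a: "a \<in> carrier G" and b: "b \<in> carrier G" for a b
    proof -
      obtain z m z' m' where *: "z \<in> center G" "m \<in> M" "z' \<in> center G" "m' \<in> M"
        "a = z \<otimes> m" "b = z' \<otimes> m'"
        using a b unfolding 2[symmetric] by (auto simp: K_def)
      have "commutator G a b = commutator G z b \<otimes> commutator G m b"
        using * MG ZG b cen by (simp only: *(5)) (rule commutator_mult_left_central, auto)
      also have "commutator G z b = \<one>"
        using *(1) b by (simp add: center_iff_commutator)
      also have "commutator G m b = commutator G m z' \<otimes> commutator G m m'"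
        using * MG ZG cen by (simp add: commutator_mult_right_central)
      also have "commutator G m z' = \<one>"
        using * MG ZG center_memD[OF *(3) MG[OF *(2)]] by (simp add: commutator_eq_one_iff)
      finally have "commutator G a b = commutator G m m'"
        using * MG by simp
      then show ?thesis
        using * subgroup.m_closed[OF sub] subgroup.m_inv_closed[OF sub] by (simp add: commutator_def)
    qed
    then show ?thesis
      using commutator_subgroup_subset[OF sub] eq by simp
  qed
qed

text \<open>Commutators lie in a center of exponent \<open>p\<close>, so \<open>p\<close>-th powers
  are central and orders divide \<open>p ^ 2\<close>. The Frattini subgroup contains the center
  because every maximal subgroup does, and it is no larger because centralizers of noncentral
  elements are maximal.\<close>

lemma extraspecialI:
  assumes p: "Factorial_Ring.prime p"
    and eq: "center G = commutator_subgroup G" and card: "card (center G) = p"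
  shows "extraspecial_group p G"
proof -
  have cen: "commutator G a b \<in> center G" if "a \<in> carrier G" "b \<in> carrier G" for a b
    using that commutator_in_derived eq by simp
  have "\<exists>n. ord x = p ^ n" if x: "x \<in> carrier G" for x
  proof -
    have "commutator G g (x [^] p) = \<one>" if g: "g \<in> carrier G" for g
      using g x cen prime_order_subgroup_exponent[OF center_subgroup card p]
      by (simp add: commutator_pow_right_central)
    then have "x [^] p \<in> center G"
      using x by (auto simp: center_def commutator_eq_one_iff)
    then have "(x [^] p) [^] p = \<one>"
      by (rule prime_order_subgroup_exponent[OF center_subgroup card p])
    then have "ord x dvd p ^ 2"
      using x by (simp add: nat_pow_pow pow_eq_id power2_eq_square)
    then show ?thesis
      using p by (auto simp: divides_primepow_nat)
  qed
  then have "p_group p G"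
    using p is_group by (simp add: p_group_def)
  moreover have "frattini G = center G"
  proof
    show "center G \<subseteq> frattini G"
      using central_commutator_subgroup_subset_maximal[OF eq] center_closed
      by (auto simp: frattini_def)
    show "frattini G \<subseteq> center G"
    proof (rule subsetI, rule ccontr)
      fix u assume u: "u \<in> frattini G" "u \<notin> center G"
      then have uG: "u \<in> carrier G" by (simp add: frattini_def)
      then obtain v where v: "v \<in> carrier G" "u \<otimes> v \<noteq> v \<otimes> u"
        using u by (auto simp: center_def)
      then have "v \<notin> center G"
        using uG center_memD[of v u] by auto
      then have "u \<in> centralizer v"
        using u(1) centralizer_maximal[OF p card cen v(1)] by (auto simp: frattini_def)
      then show False
        using v(2) by (simp add: centralizer_def)
    qed
  qed
  ultimately show ?thesis
    using eq card by (simp add: extraspecial_group_def special_group_def)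
qed

end

text \<open>Here \<open>H\<close> is an extension of \<open>G/Z(G)\<close> by a copy of \<open>[G, G]\<close> in which commutators are those
  of \<open>G\<close>. The equation for \<open>u v\<close> avoids inverses, so that it can be checked by multiplying out.\<close>

locale commutator_lift =
  G: group G + H: group H + \<pi>: group_hom H "G Mod center G" \<pi>
  for G :: "('a, 'c) monoid_scheme" and H :: "('b, 'd) monoid_scheme" and \<pi> +
  fixes \<kappa> :: "'a \<Rightarrow> 'b"
  assumes surj: "\<pi> ` carrier H = carrier (G Mod center G)"
    and \<kappa>_hom: "\<kappa> \<in> hom (G\<lparr>carrier := commutator_subgroup G\<rparr>) H"
    and \<kappa>_inj: "inj_on \<kappa> (commutator_subgroup G)"
    and \<kappa>_kernel: "\<kappa> ` commutator_subgroup G = kernel H (G Mod center G) \<pi>"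
    and \<kappa>_commutator: "\<And>u v g h. u \<in> carrier H \<Longrightarrow> v \<in> carrier H \<Longrightarrow>
      g \<in> carrier G \<Longrightarrow> h \<in> carrier G \<Longrightarrow>
      \<pi> u = center G #>\<^bsub>G\<^esub> g \<Longrightarrow> \<pi> v = center G #>\<^bsub>G\<^esub> h \<Longrightarrow>
      u \<otimes>\<^bsub>H\<^esub> v = \<kappa> (commutator G g h) \<otimes>\<^bsub>H\<^esub> (v \<otimes>\<^bsub>H\<^esub> u)"
    and commutators: "\<And>n. n \<in> commutator_subgroup G \<Longrightarrow>
      \<exists>g \<in> carrier G. \<exists>h \<in> carrier G. n = commutator G g h"
begin

lemma commutator_subgroup_G: "subgroup (commutator_subgroup G) G"
  by (rule G.derived_is_subgroup) simp

lemma \<kappa>_closed: "n \<in> commutator_subgroup G \<Longrightarrow> \<kappa> n \<in> carrier H"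
  using \<kappa>_hom by (auto simp: hom_def)

lemma \<kappa>_one: "\<kappa> \<one>\<^bsub>G\<^esub> = \<one>\<^bsub>H\<^esub>"
  using Group.hom_one[OF \<kappa>_hom] G.subgroup_imp_group[OF commutator_subgroup_G] H.is_group by simp

lemma lift_ex: "g \<in> carrier G \<Longrightarrow> \<exists>u \<in> carrier H. \<pi> u = center G #>\<^bsub>G\<^esub> g"
  using surj by (metis carrier_FactGroup imageE imageI)

lemma proj_ex: "u \<in> carrier H \<Longrightarrow> \<exists>g \<in> carrier G. \<pi> u = center G #>\<^bsub>G\<^esub> g"
  using imageI[of u "carrier H" \<pi>] surj by (auto simp: carrier_FactGroup)

lemma commutator_H:
  assumes "u \<in> carrier H" "v \<in> carrier H" "g \<in> carrier G" "h \<in> carrier G"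
    "\<pi> u = center G #>\<^bsub>G\<^esub> g" "\<pi> v = center G #>\<^bsub>G\<^esub> h"
  shows "commutator H u v = \<kappa> (commutator G g h)"
  using H.commutator_eq_iff[OF assms(1,2) \<kappa>_closed[OF G.commutator_in_derived[OF assms(3,4)]]]
    \<kappa>_commutator[OF assms] by simp

text \<open>As \<open>\<kappa>\<close> is injective, \<open>u\<close> is central in \<open>H\<close>
  iff a representative of \<open>\<pi> u\<close> is central in \<open>G\<close>, that is, iff
  \<open>\<pi> u\<close> is trivial.\<close>

lemma center_H: "center H = kernel H (G Mod center G) \<pi>"
proof
  show "center H \<subseteq> kernel H (G Mod center G) \<pi>"
  proof
    fix u assume u: "u \<in> center H"
    then obtain g where g: "g \<in> carrier G" "\<pi> u = center G #>\<^bsub>G\<^esub> g"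
      using proj_ex H.center_closed by blast
    have "commutator G g h = \<one>\<^bsub>G\<^esub>" if h: "h \<in> carrier G" for h
    proof -
      obtain v where v: "v \<in> carrier H" "\<pi> v = center G #>\<^bsub>G\<^esub> h"
        using lift_ex[OF h] by blast
      have "\<kappa> (commutator G g h) = \<kappa> \<one>\<^bsub>G\<^esub>"
        using commutator_H[OF H.center_closed[OF u] v(1) g(1) h g(2) v(2)] u v(1) \<kappa>_one
        by (simp add: H.center_iff_commutator)
      then show ?thesis
        using inj_onD[OF \<kappa>_inj] G.commutator_in_derived[OF g(1) h]
          subgroup.one_closed[OF commutator_subgroup_G] by blast
    qed
    then have "g \<in> center G"
      using g by (simp add: G.center_iff_commutator)
    then have "\<pi> u = \<one>\<^bsub>G Mod center G\<^esub>"
      using g G.coset_join2[OF g(1) G.center_subgroup] by simp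
    then show "u \<in> kernel H (G Mod center G) \<pi>"
      using u H.center_closed by (simp add: kernel_def)
  qed
next
  show "kernel H (G Mod center G) \<pi> \<subseteq> center H"
  proof
    fix u assume "u \<in> kernel H (G Mod center G) \<pi>"
    then have u: "u \<in> carrier H" "\<pi> u = center G #>\<^bsub>G\<^esub> \<one>\<^bsub>G\<^esub>"
      using G.coset_join2[OF _ G.center_subgroup] subgroup.one_closed[OF G.center_subgroup]
      by (auto simp: kernel_def)
    have "commutator H u v = \<one>\<^bsub>H\<^esub>" if v: "v \<in> carrier H" for v
    proof -
      obtain h where h: "h \<in> carrier G" "\<pi> v = center G #>\<^bsub>G\<^esub> h"
        using proj_ex[OF v] by blast
      then show ?thesis
        using commutator_H[OF u(1) v G.one_closed h(1) u(2) h(2)] \<kappa>_one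
        by (simp add: commutator_def)
    qed
    then show "u \<in> center H"
      using u by (simp add: H.center_iff_commutator)
  qed
qed

text \<open>From left to right, the image is a subgroup because it is a kernel. Conversely, each
  element of the commutator subgroup of \<open>G\<close> is a single commutator, so lifting its two
  entries suffices.\<close>

lemma commutator_subgroup_H: "commutator_subgroup H = \<kappa> ` commutator_subgroup G"
proof
  have "commutator H u v \<in> \<kappa> ` commutator_subgroup G"
    if u: "u \<in> carrier H" and v: "v \<in> carrier H" for u v
    using proj_ex[OF u] proj_ex[OF v] commutator_H[OF u v] G.commutator_in_derived by auto
  then show "commutator_subgroup H \<subseteq> \<kappa> ` commutator_subgroup G"
    using H.commutator_subgroup_subset \<pi>.subgroup_kernel \<kappa>_kernel by simp
  show "\<kappa> ` commutator_subgroup G \<subseteq> commutator_subgroup H"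
  proof
    fix c assume "c \<in> \<kappa> ` commutator_subgroup G"
    then obtain g h where gh: "g \<in> carrier G" "h \<in> carrier G" "c = \<kappa> (commutator G g h)"
      using commutators by blast
    obtain u v where uv: "u \<in> carrier H" "\<pi> u = center G #>\<^bsub>G\<^esub> g" "v \<in> carrier H" "\<pi> v = center G #>\<^bsub>G\<^esub> h"
      using lift_ex gh by meson
    have "c = commutator H u v"
      using commutator_H[OF uv(1,3) gh(1,2) uv(2,4)] gh(3) by simp
    then show "c \<in> commutator_subgroup H"
      using H.commutator_in_derived uv by simp
  qed
qed

lemma extraspecial:
  assumes "Factorial_Ring.prime p" "card (commutator_subgroup G) = p"
  shows "extraspecial_group p H"
proof (rule H.extraspecialI[OF assms(1)])
  show "center H = commutator_subgroup H"
    by (simp add: center_H commutator_subgroup_H \<kappa>_kernel)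
  show "card (center H) = p"
    using assms(2) by (simp add: center_H card_image[OF \<kappa>_inj] flip: \<kappa>_kernel)
qed

text \<open>The kernel of \<open>\<pi>\<close> is the center of \<open>H\<close>, so
  \<open>\<pi>\<close> induces an isomorphism \<open>f\<close> of central quotients. Its inverse
  serves as \<open>\<alpha>\<close>, and \<open>\<kappa>\<close> serves as
  \<open>\<beta>\<close>.\<close>

lemma isoclinic_lift: "isoclinic G H"
proof -
  \<comment> \<open>\<open>\<pi>\<close> is constant on cosets of its kernel, so the image of a
    coset is a singleton.\<close>
  define f where "f = (\<lambda>U. the_elem (\<pi> ` U))"
  have f: "f \<in> iso (H Mod center H) (G Mod center G)"
    using \<pi>.FactGroup_iso_set[OF surj] by (simp add: f_def center_H)
  have group_Mod: "group (H Mod center H)"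
    by (rule normal.factorgroup_is_group[OF H.center_normal])
  define \<alpha> where "\<alpha> = inv_into (carrier (H Mod center H)) f"
  have \<alpha>: "\<alpha> \<in> iso (G Mod center G) (H Mod center H)"
    unfolding \<alpha>_def by (rule group.iso_set_sym[OF group_Mod f])
  have f_coset: "f (center H #>\<^bsub>H\<^esub> u) = \<pi> u" if u: "u \<in> carrier H" for u
  proof -
    have "\<pi> ` (center H #>\<^bsub>H\<^esub> u) = {\<pi> u}"
    proof -
      have "\<pi> (z \<otimes>\<^bsub>H\<^esub> u) = \<pi> u" if "z \<in> center H" for z
        using that u \<pi>.H.l_one[of "\<pi> u"] by (simp add: center_H kernel_def)
      moreover have "u \<in> center H #>\<^bsub>H\<^esub> u"
        by (rule H.rcos_self[OF u H.center_subgroup])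
      ultimately show ?thesis
        by (auto simp: r_coset_def)
    qed
    then show ?thesis by (simp add: f_def)
  qed
  \<comment> \<open>Applying \<open>f\<close> turns the condition on \<open>\<alpha>\<close> in
    \<open>isoclinic\<close> into the one on \<open>\<pi>\<close> that \<open>commutator_H\<close>
    takes.\<close>
  have proj: "\<pi> u = center G #>\<^bsub>G\<^esub> g"
    if "g \<in> carrier G" "u \<in> carrier H" "\<alpha> (center G #>\<^bsub>G\<^esub> g) = center H #>\<^bsub>H\<^esub> u" for g u
  proof -
    have "center G #>\<^bsub>G\<^esub> g \<in> f ` carrier (H Mod center H)"
      using f that(1) by (auto simp: iso_def bij_betw_def carrier_FactGroup)
    then have "f (\<alpha> (center G #>\<^bsub>G\<^esub> g)) = center G #>\<^bsub>G\<^esub> g"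
      unfolding \<alpha>_def by (rule f_inv_into_f)
    then show ?thesis
      using that f_coset by simp
  qed
  have \<beta>: "\<kappa> \<in> iso (G\<lparr>carrier := commutator_subgroup G\<rparr>) (H\<lparr>carrier := commutator_subgroup H\<rparr>)"
    using \<kappa>_hom \<kappa>_inj by (auto simp: iso_def hom_def bij_betw_def commutator_subgroup_H)
  show ?thesis
    unfolding isoclinic_def
    using G.is_group H.is_group commutator_H proj
    by (intro conjI bexI[OF _ \<alpha>] bexI[OF _ \<beta>]) auto
qed

end

section \<open>The twisted product\<close>

text \<open>For biadditive \<open>b\<close> this is the central extension of \<open>Q\<close> by Z/p
  with 2-cocycle \<open>b\<close>, Z/p being modelled by least residues. Over commuting
  \<open>u\<close> and \<open>v\<close>, commutators have first component
  \<open>b u v - b v u\<close> modulo \<open>p\<close>.\<close>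

definition twisted_product :: "int \<Rightarrow> ('a, 'b) monoid_scheme \<Rightarrow> ('a \<Rightarrow> 'a \<Rightarrow> int) \<Rightarrow> (int \<times> 'a) monoid" where
  "twisted_product p Q b =
     \<lparr>carrier = {0..<p} \<times> carrier Q,
      monoid.mult = (\<lambda>(s, u) (t, v). ((s + t + b u v) mod p, u \<otimes>\<^bsub>Q\<^esub> v)),
      one = (0, \<one>\<^bsub>Q\<^esub>)\<rparr>"

context group
begin

lemma biadditive_mod_one:
  assumes b: "biadditive_mod p G b" and g: "g \<in> carrier G"
  shows "[b \<one> g = 0] (mod p)" "[b g \<one> = 0] (mod p)"
  using biadditive_mod_left[OF b one_closed one_closed g]
    biadditive_mod_right[OF b one_closed one_closed g]
  by (simp_all add: cong_iff_dvd_diff)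

text \<open>Associativity is the cocycle identity: modulo \<open>p\<close>, both bracketings
  contribute \<open>b u v + b u w + b v w\<close>.\<close>

lemma twisted_product_group:
  assumes b: "biadditive_mod p G b" and p: "p > 0"
  shows "group (twisted_product p G b)"
proof (rule groupI)
  fix x y z
  assume "x \<in> carrier (twisted_product p G b)" "y \<in> carrier (twisted_product p G b)"
    "z \<in> carrier (twisted_product p G b)"
  then obtain r u s v t w where *: "x = (r, u)" "y = (s, v)" "z = (t, w)"
    "u \<in> carrier G" "v \<in> carrier G" "w \<in> carrier G"
    by (auto simp: twisted_product_def)
  have "[((r + s + b u v) mod p) + t + b (u \<otimes> v) w = (r + s + b u v) + t + (b u w + b v w)] (mod p)"
    by (intro cong_add cong_refl biadditive_mod_left[OF b] *) simp
  also have "(r + s + b u v) + t + (b u w + b v w) = r + (s + t + b v w) + (b u v + b u w)"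
    by simp
  also have "[\<dots> = r + ((s + t + b v w) mod p) + b u (v \<otimes> w)] (mod p)"
    by (rule cong_sym, intro cong_add cong_refl biadditive_mod_right[OF b] *) simp
  finally show "x \<otimes>\<^bsub>twisted_product p G b\<^esub> y \<otimes>\<^bsub>twisted_product p G b\<^esub> z
      = x \<otimes>\<^bsub>twisted_product p G b\<^esub> (y \<otimes>\<^bsub>twisted_product p G b\<^esub> z)"
    using * by (simp add: twisted_product_def m_assoc cong_def)
next
  fix x assume "x \<in> carrier (twisted_product p G b)"
  then obtain r u where x: "x = (r, u)" "0 \<le> r" "r < p" "u \<in> carrier G"
    by (auto simp: twisted_product_def)
  have "[0 + r + b \<one> u = 0 + r + 0] (mod p)"
    by (intro cong_add cong_refl biadditive_mod_one[OF b] x)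
  then show "\<one>\<^bsub>twisted_product p G b\<^esub> \<otimes>\<^bsub>twisted_product p G b\<^esub> x = x"
    using x by (simp add: twisted_product_def cong_def)
  \<comment> \<open>The first component of the left inverse also has to cancel the cocycle value
    \<open>b (inv u) u\<close>.\<close>
  have "((- r - b (inv u) u) mod p + r + b (inv u) u) mod p = ((- r - b (inv u) u) + (r + b (inv u) u)) mod p"
    by (simp only: add.assoc mod_add_left_eq)
  then have "((- r - b (inv u) u) mod p, inv u) \<otimes>\<^bsub>twisted_product p G b\<^esub> x = \<one>\<^bsub>twisted_product p G b\<^esub>"
    using x by (simp add: twisted_product_def)
  moreover have "((- r - b (inv u) u) mod p, inv u) \<in> carrier (twisted_product p G b)"
    using x p by (simp add: twisted_product_def)
  ultimately show "\<exists>y \<in> carrier (twisted_product p G b).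
      y \<otimes>\<^bsub>twisted_product p G b\<^esub> x = \<one>\<^bsub>twisted_product p G b\<^esub>"
    by blast
qed (use p in \<open>auto simp: twisted_product_def\<close>)

text \<open>Makes the commutator a function of two cosets. A central factor in the left argument
  contributes a trivial commutator; the right argument reduces to the left one by
  \<open>commutator_swap\<close>.\<close>

lemma commutator_center_coset_cong:
  assumes g: "g \<in> carrier G" "g' \<in> carrier G" "center_coset g = center_coset g'"
    and h: "h \<in> carrier G" "h' \<in> carrier G" "center_coset h = center_coset h'"
  shows "commutator G g h = commutator G g' h'"
proof -
  have left: "commutator G a k = commutator G a' k"
    if a: "a \<in> carrier G" "a' \<in> carrier G" "center_coset a = center_coset a'" and k: "k \<in> carrier G"
    for a a' k
  proof -
    have z: "a \<otimes> inv a' \<in> center G"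
      using a center_coset_eq_iff by simp
    have comm: "commutator G (a \<otimes> inv a') k = \<one>"
      using z k by (simp add: center_iff_commutator)
    have eq: "a = a' \<otimes> (a \<otimes> inv a')"
      using center_memD[OF z a(2)] a by (simp add: m_assoc)
    have "commutator G (a' \<otimes> (a \<otimes> inv a')) k = commutator G a' k \<otimes> commutator G (a \<otimes> inv a') k"
      using a k comm subgroup.one_closed[OF center_subgroup] by (intro commutator_mult_left_central) auto
    then show ?thesis
      using comm a k by (simp flip: eq)
  qed
  have "commutator G g h = commutator G g' h"
    by (rule left[OF g h(1)])
  also have "\<dots> = inv (commutator G h g')"
    by (rule commutator_swap[OF h(1) g(2)])
  also have "\<dots> = inv (commutator G h' g')"
    using left[OF h g(2)] by simp
  also have "\<dots> = commutator G g' h'"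
    by (rule commutator_swap[OF h(2) g(2), symmetric])
  finally show ?thesis .
qed

text \<open>Brings the twisted product, whose elements are pairs of an integer and a coset, to the
  type \<open>nat\<close>.\<close>

lemma exists_nat_copy:
  assumes "finite (carrier G)"
  obtains H :: "nat monoid" and e where "group H" "finite (carrier H)" "e \<in> iso G H"
proof -
  obtain e :: "'a \<Rightarrow> nat" where e: "inj_on e (carrier G)"
    using finite_imp_inj_to_nat_seg[OF assms] by blast
  show thesis
  proof (rule that)
    show "e \<in> iso G (image_group e G)"
      by (rule inj_imp_image_group_iso[OF e])
    show "group (image_group e G)"
      by (rule inj_imp_image_group_is_group[OF e])
    show "finite (carrier (image_group e G))"
      using assms by (simp add: image_group_carrier)
  qed
qed

end

section \<open>Construction of the extraspecial group from the commutator form\<close>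

lemma (in group) two_class_sizes_isoclinic_extraspecial:
  assumes p: "Factorial_Ring.prime p" and fin: "finite (carrier G)"
    and sizes: "conjugacy_class_sizes G = {1, p}"
  shows "\<exists>H :: nat monoid. finite (carrier H) \<and> extraspecial_group p H \<and> isoclinic G H"
proof -
  let ?Q = "G Mod center G" and ?N = "commutator_subgroup G"
  obtain x where x: "x \<in> carrier G" and N_eq: "?N = commutator G x ` carrier G"
    and N_center: "?N \<subseteq> center G" and N_card: "card ?N = p"
    using two_class_sizes_commutators[OF fin p sizes] by blast
  have subN: "subgroup ?N G"
    by (rule derived_is_subgroup) simp
  have p0: "int p > 0" and pp: "Factorial_Ring.prime (int p)"
    using p prime_gt_0_nat by auto
  \<comment> \<open>A generator of \<open>?N\<close>, which has prime order; its exponents identify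
    \<open>?N\<close> with Z/p.\<close>
  obtain c where c: "c \<in> ?N" "c \<noteq> \<one>"
  proof -
    have "?N \<noteq> {\<one>}"
      using N_card p by auto
    then show ?thesis
      using that subgroup.one_closed[OF subN] by blast
  qed
  have cG: "c \<in> carrier G"
    using c(1) subN subgroup.mem_carrier by metis
  have c_pow_eq: "c [^] i = c [^] j \<longleftrightarrow> [i = j] (mod int p)" for i j :: int
    using int_pow_eq[OF cG, of i j] prime_order_subgroup_ord[OF subN N_card p c]
    by (simp add: cong_iff_dvd_diff dvd_diff_commute)
  have "\<exists>i::int. c [^] i = n" if "n \<in> ?N" for n
    using prime_order_subgroup_power[OF subN N_card p c that] by (metis int_pow_int)
  \<comment> \<open>A discrete logarithm to base \<open>c\<close>, meaningful only modulo
    \<open>p\<close>.\<close>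
  then obtain lg :: "'a \<Rightarrow> int" where lg: "\<And>n. n \<in> ?N \<Longrightarrow> c [^] lg n = n"
    by metis
  \<comment> \<open>The commutator form on \<open>?Q\<close>, evaluated at chosen representatives;
    \<open>commutator_center_coset_cong\<close> makes the choice harmless.\<close>
  define w where "w U V = lg (commutator G (SOME g. g \<in> U) (SOME h. h \<in> V))" for U V
  have Q_cases: "\<exists>g \<in> carrier G. U = center_coset g" if "U \<in> carrier ?Q" for U
    using that by (auto simp: carrier_FactGroup)
  have rep: "(SOME h. h \<in> center_coset g) \<in> carrier G"
    "center_coset (SOME h. h \<in> center_coset g) = center_coset g" if g: "g \<in> carrier G" for g
  proof -
    have some: "(SOME h. h \<in> center_coset g) \<in> center_coset g"
      by (rule someI[of "\<lambda>h. h \<in> center_coset g"], rule rcos_self[OF g center_subgroup])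
    show "(SOME h. h \<in> center_coset g) \<in> carrier G"
      using some subgroup.elemrcos_carrier[OF center_subgroup is_group g] by blast
    show "center_coset (SOME h. h \<in> center_coset g) = center_coset g"
      using repr_independence[OF some g center_subgroup] by simp
  qed
  have w: "c [^] w (center_coset g) (center_coset h) = commutator G g h"
    if g: "g \<in> carrier G" and h: "h \<in> carrier G" for g h
    using lg[OF commutator_in_derived[OF rep(1)[OF g] rep(1)[OF h]]]
      commutator_center_coset_cong[OF rep(1)[OF g] g rep(2)[OF g] rep(1)[OF h] h rep(2)[OF h]]
    by (simp add: w_def)
  have coset_mult: "center_coset g \<otimes>\<^bsub>?Q\<^esub> center_coset h = center_coset (g \<otimes> h)"
    if "g \<in> carrier G" "h \<in> carrier G" for g h
    using that group_hom.hom_mult[OF center_coset_group_hom] by simp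
  have cen: "commutator G g h \<in> center G" if "g \<in> carrier G" "h \<in> carrier G" for g h
    using that commutator_in_derived N_center by blast
  have w_biadd: "biadditive_mod (int p) ?Q w"
    unfolding biadditive_mod_def
  proof (intro ballI)
    fix U V W assume "U \<in> carrier ?Q" "V \<in> carrier ?Q" "W \<in> carrier ?Q"
    then obtain g h k where *: "g \<in> carrier G" "h \<in> carrier G" "k \<in> carrier G"
      "U = center_coset g" "V = center_coset h" "W = center_coset k"
      using Q_cases by meson
    have "c [^] w (center_coset (g \<otimes> h)) W = c [^] (w U W + w V W)"
      using * cG w cen by (simp add: commutator_mult_left_central int_pow_mult)
    moreover have "c [^] w W (center_coset (g \<otimes> h)) = c [^] (w W U + w W V)"
      using * cG w cen by (simp add: commutator_mult_right_central int_pow_mult)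
    ultimately show "[w (U \<otimes>\<^bsub>?Q\<^esub> V) W = w U W + w V W] (mod int p) \<and>
        [w W (U \<otimes>\<^bsub>?Q\<^esub> V) = w W U + w W V] (mod int p)"
      unfolding c_pow_eq using coset_mult[OF *(1,2)] *(4,5) by simp
  qed
  have w_alt: "[w U U = 0] (mod int p)" if U: "U \<in> carrier ?Q" for U
  proof -
    obtain g where g: "g \<in> carrier G" "U = center_coset g"
      using Q_cases[OF U] by blast
    have "c [^] w U U = c [^] (0::int)"
      using w[OF g(1) g(1)] g commutator_self by simp
    then show ?thesis by (simp only: c_pow_eq)
  qed
  interpret Q: group ?Q
    by (rule normal.factorgroup_is_group[OF center_normal])
  have fin_Q: "finite (carrier ?Q)"
    using fin by (simp add: carrier_FactGroup)
  \<comment> \<open>The cocycle: its antisymmetrization is the commutator form.\<close>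
  obtain b where b: "biadditive_mod (int p) ?Q b"
    and wb: "\<And>U V. U \<in> carrier ?Q \<Longrightarrow> V \<in> carrier ?Q \<Longrightarrow> [w U V = b U V - b V U] (mod int p)"
    using Q.alternating_mod_eq_antisymmetrization[OF fin_Q pp w_biadd w_alt] by blast
  define K where "K = twisted_product (int p) ?Q b"
  interpret K: group K
    unfolding K_def by (rule Q.twisted_product_group[OF b p0])
  have K_carrier: "carrier K = {0..<int p} \<times> carrier ?Q"
    and K_mult: "(s, U) \<otimes>\<^bsub>K\<^esub> (t, V) = ((s + t + b U V) mod int p, U \<otimes>\<^bsub>?Q\<^esub> V)" for s U t V
    by (simp_all add: K_def twisted_product_def)
  have fin_K: "finite (carrier K)"
    using fin_Q by (simp add: K_carrier)
  \<comment> \<open>Embeds \<open>?N\<close> into \<open>K\<close> as the central copy of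
    Z/p.\<close>
  define \<theta> where "\<theta> n = (lg n mod int p, \<one>\<^bsub>?Q\<^esub>)" for n
  have \<theta>_closed: "\<theta> n \<in> carrier K" for n
    using p0 by (simp add: \<theta>_def K_carrier del: one_FactGroup)
  have \<theta>_mult: "\<theta> (m \<otimes> n) = \<theta> m \<otimes>\<^bsub>K\<^esub> \<theta> n" if m: "m \<in> ?N" and n: "n \<in> ?N" for m n
  proof -
    have "c [^] lg (m \<otimes> n) = c [^] (lg m + lg n)"
      using m n cG subgroup.m_closed[OF subN] by (simp add: lg int_pow_mult)
    then have "[lg (m \<otimes> n) = lg m + lg n] (mod int p)"
      by (simp only: c_pow_eq)
    \<comment> \<open>The product in \<open>K\<close> adds the cocycle value at the identity, which
      vanishes modulo \<open>p\<close>.\<close>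
    also have "[lg m + lg n = lg m mod int p + lg n mod int p + b \<one>\<^bsub>?Q\<^esub> \<one>\<^bsub>?Q\<^esub>] (mod int p)"
      using cong_add[OF cong_add[of "lg m" "lg m mod int p" "int p" "lg n" "lg n mod int p"]
          cong_sym[OF Q.biadditive_mod_one(1)[OF b Q.one_closed]]] by (simp del: one_FactGroup)
    finally show ?thesis
      by (simp add: \<theta>_def K_mult cong_def del: one_FactGroup mult_FactGroup)
  qed
  have \<theta>_inj: "inj_on \<theta> ?N"
  proof (rule inj_onI)
    fix m n assume mn: "m \<in> ?N" "n \<in> ?N" "\<theta> m = \<theta> n"
    then have "c [^] lg m = c [^] lg n"
      unfolding c_pow_eq by (simp add: \<theta>_def cong_def)
    then show "m = n" using lg mn by simp
  qed
  have \<theta>_image: "\<theta> ` ?N = {0..<int p} \<times> {\<one>\<^bsub>?Q\<^esub>}"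
  proof
    show "\<theta> ` ?N \<subseteq> {0..<int p} \<times> {\<one>\<^bsub>?Q\<^esub>}"
      using p0 by (auto simp: \<theta>_def)
    show "{0..<int p} \<times> {\<one>\<^bsub>?Q\<^esub>} \<subseteq> \<theta> ` ?N"
    proof
      fix y assume "y \<in> {0..<int p} \<times> {\<one>\<^bsub>?Q\<^esub>}"
      then obtain s where s: "0 \<le> s" "s < int p" "y = (s, \<one>\<^bsub>?Q\<^esub>)"
        by auto
      have n: "c [^] s \<in> ?N"
        by (rule subgroup_int_pow_closed[OF subN c(1)])
      have "[lg (c [^] s) = s] (mod int p)"
        using lg[OF n] by (simp only: c_pow_eq)
      then have "y = \<theta> (c [^] s)"
        using s by (simp add: \<theta>_def cong_def)
      then show "y \<in> \<theta> ` ?N" using n by blast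
    qed
  qed
  \<comment> \<open>\<open>H\<close> is a copy of \<open>K\<close> on \<open>nat\<close>;
    \<open>d\<close> inverts \<open>e\<close>, so that computations can be carried out in
    \<open>K\<close>.\<close>
  obtain H :: "nat monoid" and e where H: "group H" "finite (carrier H)" and e: "e \<in> iso K H"
    using K.exists_nat_copy[OF fin_K] by blast
  define d where "d = inv_into (carrier K) e"
  have d: "d \<in> iso H K"
    unfolding d_def by (rule K.iso_set_sym[OF e])
  have d_hom: "d \<in> hom H K" and d_image: "d ` carrier H = carrier K"
    using d by (auto simp: iso_def bij_betw_def)
  have e_hom: "e \<in> hom K H" and e_image: "e ` carrier K = carrier H" and e_inj: "inj_on e (carrier K)"
    using e by (auto simp: iso_def bij_betw_def)
  have de: "d (e y) = y" if "y \<in> carrier K" for y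
    using that e_inj by (simp add: d_def)
  have ed: "e (d u) = u" if "u \<in> carrier H" for u
    using that unfolding e_image[symmetric] d_def by (rule f_inv_into_f)
  have dK: "d u \<in> carrier K" if "u \<in> carrier H" for u
    using that d_image by blast
  have eH: "e y \<in> carrier H" if "y \<in> carrier K" for y
    using that e_image by blast
  have proj: "snd \<circ> d \<in> hom H ?Q"
  proof (rule homI)
    fix u assume "u \<in> carrier H"
    then show "(snd \<circ> d) u \<in> carrier ?Q"
      using dK by (auto simp: K_carrier mem_Times_iff)
  next
    fix u v assume "u \<in> carrier H" "v \<in> carrier H"
    then have "d (u \<otimes>\<^bsub>H\<^esub> v) = d u \<otimes>\<^bsub>K\<^esub> d v"
      using d_hom by (simp add: hom_def)
    then show "(snd \<circ> d) (u \<otimes>\<^bsub>H\<^esub> v) = (snd \<circ> d) u \<otimes>\<^bsub>?Q\<^esub> (snd \<circ> d) v"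
      by (cases "d u", cases "d v") (simp add: K_mult)
  qed
  have "commutator_lift G H (snd \<circ> d) (e \<circ> \<theta>)"
  proof (intro commutator_lift.intro commutator_lift_axioms.intro)
    show "group G" by (rule is_group)
    show "group H" by (rule H(1))
    show "group_hom H ?Q (snd \<circ> d)"
      using H(1) Q.is_group proj by (simp add: group_hom_def group_hom_axioms_def)
    show "(snd \<circ> d) ` carrier H = carrier ?Q"
      using p0 by (simp only: image_comp[symmetric] d_image K_carrier) auto
    show "e \<circ> \<theta> \<in> hom (G\<lparr>carrier := ?N\<rparr>) H"
      using e_hom \<theta>_closed \<theta>_mult eH by (auto simp: hom_def)
    show "inj_on (e \<circ> \<theta>) ?N"
      by (rule comp_inj_on[OF \<theta>_inj]) (use e_inj \<theta>_closed in \<open>auto intro: inj_on_subset\<close>)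
    show "(e \<circ> \<theta>) ` ?N = kernel H ?Q (snd \<circ> d)"
    proof
      show "(e \<circ> \<theta>) ` ?N \<subseteq> kernel H ?Q (snd \<circ> d)"
        using \<theta>_closed eH de by (auto simp: kernel_def) (simp add: \<theta>_def)+
      show "kernel H ?Q (snd \<circ> d) \<subseteq> (e \<circ> \<theta>) ` ?N"
      proof
        fix u assume "u \<in> kernel H ?Q (snd \<circ> d)"
        then have u: "u \<in> carrier H" "snd (d u) = \<one>\<^bsub>?Q\<^esub>"
          by (auto simp: kernel_def)
        then have "d u \<in> \<theta> ` ?N"
          unfolding \<theta>_image using dK[OF u(1)] by (simp add: K_carrier mem_Times_iff)
        then show "u \<in> (e \<circ> \<theta>) ` ?N"
          using ed[OF u(1)] by (metis comp_apply imageE imageI)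
      qed
    qed
    show "\<exists>g \<in> carrier G. \<exists>h \<in> carrier G. n = commutator G g h" if "n \<in> ?N" for n
      using that x N_eq by blast
    fix u v g h
    assume u: "u \<in> carrier H" and v: "v \<in> carrier H" and g: "g \<in> carrier G" and h: "h \<in> carrier G"
      and ug: "(snd \<circ> d) u = center_coset g" and vh: "(snd \<circ> d) v = center_coset h"
    define U V where "U = center_coset g" and "V = center_coset h"
    have UV: "U \<in> carrier ?Q" "V \<in> carrier ?Q"
      using g h by (auto simp: U_def V_def carrier_FactGroup)
    obtain s t where st: "d u = (s, U)" "d v = (t, V)"
      using ug vh by (cases "d u", cases "d v") (auto simp: U_def V_def)
    let ?n = "commutator G g h"
    have n: "?n \<in> ?N" using commutator_in_derived[OF g h] .
    have "c [^] lg ?n = c [^] w U V"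
      using lg[OF n] w[OF g h] by (simp add: U_def V_def)
    then have "[lg ?n = w U V] (mod int p)" by (simp only: c_pow_eq)
    then have lg_n: "[lg ?n = b U V - b V U] (mod int p)"
      using wb[OF UV] cong_trans by blast
    \<comment> \<open>All commutators of \<open>G\<close> are central, so \<open>?Q\<close> is
      abelian and the second components of the two products agree.\<close>
    have comm: "U \<otimes>\<^bsub>?Q\<^esub> V = V \<otimes>\<^bsub>?Q\<^esub> U"
      using coset_mult g h center_coset_commute_iff[OF g h] cen[OF g h] by (simp add: U_def V_def)
    have VU: "V \<otimes>\<^bsub>?Q\<^esub> U \<in> carrier ?Q"
      by (rule Q.m_closed[OF UV(2,1)])
    \<comment> \<open>The first components before reduction, \<open>s + t + b U V\<close> and
      \<open>t + s + b V U\<close>, differ by \<open>b U V - b V U\<close>, which is the logarithm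
      of \<open>?n\<close> modulo \<open>p\<close>.\<close>
    have "[lg ?n mod int p + (t + s + b V U) mod int p + b \<one>\<^bsub>?Q\<^esub> (V \<otimes>\<^bsub>?Q\<^esub> U)
        = (b U V - b V U) + (t + s + b V U) + 0] (mod int p)"
      by (intro cong_add Q.biadditive_mod_one(1)[OF b VU]) (use lg_n in \<open>simp_all add: cong_def\<close>)
    then have fst_eq: "[s + t + b U V = lg ?n mod int p + (t + s + b V U) mod int p
        + b \<one>\<^bsub>?Q\<^esub> (V \<otimes>\<^bsub>?Q\<^esub> U)] (mod int p)"
      by (simp add: cong_sym_eq algebra_simps del: one_FactGroup mult_FactGroup)
    have "d u \<otimes>\<^bsub>K\<^esub> d v = \<theta> ?n \<otimes>\<^bsub>K\<^esub> (d v \<otimes>\<^bsub>K\<^esub> d u)"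
      using fst_eq comm Q.l_one[OF VU] unfolding st \<theta>_def K_mult cong_def by simp
    then have "e (d u \<otimes>\<^bsub>K\<^esub> d v) = e (\<theta> ?n \<otimes>\<^bsub>K\<^esub> (d v \<otimes>\<^bsub>K\<^esub> d u))"
      by simp
    then show "u \<otimes>\<^bsub>H\<^esub> v = (e \<circ> \<theta>) ?n \<otimes>\<^bsub>H\<^esub> (v \<otimes>\<^bsub>H\<^esub> u)"
      using dK u v \<theta>_closed ed by (simp add: hom_mult[OF e_hom])
  qed
  then interpret commutator_lift G H "snd \<circ> d" "e \<circ> \<theta>" .
  show ?thesis
    using H(2) extraspecial[OF p N_card] isoclinic_lift by blast
qed

theorem theorem5p19:
  fixes G :: "('a, 'b) monoid_scheme" and p :: nat
  assumes "Factorial_Ring.prime p"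
    and "group G"
    and "finite (carrier G)"
    and "conjugacy_class_sizes G = {1, p}"
  shows "\<exists>H :: nat monoid. finite (carrier H) \<and> extraspecial_group p H \<and> isoclinic G H"
  using group.two_class_sizes_isoclinic_extraspecial[OF assms(2,1,3,4)] .

end
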